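(* Let $d\ge 3$ be an integer and let $\mathcal{H}=\{H_1,H_2\}$ be a family of connected graphs with $|\mathcal{H}|=2$. Then $\mathcal{H}$ is an inclusion-minimal element of $d\text{-}\mathrm{B}\text{-}\operatorname{def}$ (that is, $\mathcal{H}\in d\text{-}\mathrm{B}\text{-}\operatorname{def}$ and no proper subset $\mathcal{H}'\subsetneq\mathcal{H}$ belongs to $d\text{-}\mathrm{B}\text{-}\operatorname{def}$) if and only if $\mathcal{H}=\{K_{1,s},T_3\}$ or $\mathcal{H}=\{K_{1,s},P_4\}$ for some integer $s$ with $4\le s\le d+1$.
   Context: All graphs are finite and simple, and graphs in families are considered up to isomorphism. For a graph $G$ with matching number $\nu(G)$ (the size of a maximum matching), the deficiency is $\operatorname{def}(G)=|V(G)|-2\nu(G)$. A graph $G$ is $\mathcal{H}$-free if no member of $\mathcal{H}$ is isomorphic to an induced subgraph of $G$. For an integer $d$, $d\text{-}\mathrm{B}\text{-}\operatorname{def}$ denotes the collection of all families $\mathcal{H}$ of connected graphs such that $\operatorname{def}(G)<d$ for every connected $\mathcal{H}$-free graph $G$. $K_{1,s}$ is the star with $s$ leaves, $P_4$ is the path on $4$ vertices, and $T_3$ is the graph obtained from the path $P_3$ on three vertices by adding two new vertices, both of degree one and both adjacent to the same end of $P_3$ (so $T_3$ has $5$ vertices). *)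

theory Defs
  imports "Graph_Theory.Graph_Theory" "HOL-Library.Disjoint_Sets"
begin

text \<open>
  A finite simple graph is a \<^locale>\<open>pair_graph\<close>: a finite vertex set with a symmetric
  irreflexive finite arc relation. Every finite graph has a copy with vertices in
  \<^typ>\<open>nat\<close>, so \<^typ>\<open>nat\<close> is taken as the universe of vertices. The library's
  \<^const>\<open>connected\<close> requires at least one vertex, so connected graphs are nonempty.
\<close>

subsection \<open>Deficiency\<close>

definition uedges :: "'a pair_pre_digraph \<Rightarrow> 'a set set" where
  "uedges G = {{u, v} | u v. (u, v) \<in> parcs G}"

definition matching :: "'a pair_pre_digraph \<Rightarrow> 'a set set \<Rightarrow> bool" where
  "matching G M \<longleftrightarrow> M \<subseteq> uedges G \<and> disjoint M"

definition matching_number :: "'a pair_pre_digraph \<Rightarrow> nat" where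
  "matching_number G = Max {card M | M. matching G M}"

definition deficiency :: "'a pair_pre_digraph \<Rightarrow> int" where
  "deficiency G = int (card (pverts G)) - 2 * int (matching_number G)"

subsection \<open>Families of graphs up to isomorphism\<close>

text \<open>
  A graph considered up to isomorphism is the set of all its copies with vertices in
  \<^typ>\<open>nat\<close>; a family of graphs is a set of such isomorphism classes.
\<close>

type_synonym graph_class = "nat pair_pre_digraph set"

definition iso_class :: "nat pair_pre_digraph \<Rightarrow> graph_class" where
  "iso_class G = {H. pair_graph H \<and> digraph_iso (with_proj G) (with_proj H)}"

definition connected_classes :: "graph_class set" where
  "connected_classes = {iso_class G | G. pair_graph G \<and> connected (with_proj G)}"

definition family_free :: "graph_class set \<Rightarrow> nat pair_pre_digraph \<Rightarrow> bool" where
  "family_free \<H> G \<longleftrightarrow>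
     \<not> (\<exists>C\<in>\<H>. \<exists>H\<in>C. \<exists>F. induced_subgraph F (with_proj G) \<and> digraph_iso (with_proj H) F)"

text \<open>The collection $d$-B-def.\<close>

definition B_deficiency :: "int \<Rightarrow> graph_class set set" where
  "B_deficiency d = {\<H>. \<H> \<subseteq> connected_classes \<and>
     (\<forall>G. pair_graph G \<and> connected (with_proj G) \<and> family_free \<H> G \<longrightarrow> deficiency G < d)}"

subsection \<open>The graphs $K_{1,s}$, $P_n$ and $T_3$\<close>

definition star :: "nat \<Rightarrow> nat pair_pre_digraph" where
  "star s = \<lparr>pverts = {0..s}, parcs = symcl {(0, i) | i. 1 \<le> i \<and> i \<le> s}\<rparr>"

definition path_graph :: "nat \<Rightarrow> nat pair_pre_digraph" where
  "path_graph n = \<lparr>pverts = {..<n}, parcs = symcl {(i, Suc i) | i. Suc i < n}\<rparr>"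

definition T3 :: "nat pair_pre_digraph" where
  "T3 = \<lparr>pverts = pverts (path_graph 3) \<union> {3, 4},
         parcs = parcs (path_graph 3) \<union> symcl {(2, 3), (2, 4)}\<rparr>"

end

theory Submission
  imports Defs
begin

text \<open>
  The proof has one upper bound and three families of graphs of large deficiency.

  \<^emph>\<open>Upper bound.\<close> A connected graph without an induced $T_3$ and without an induced
  $K_{1,s}$, where $s \ge 3$, has deficiency at most $s - 2$
  (\<open>deficiency_le_if_fork_star_free\<close>). Removing both ends of an edge does not decrease the
  deficiency and keeps the graph free of $T_3$ and $K_{1,s}$, so it suffices to treat a connected
  graph in which no edge can be removed in this way without disconnecting the graph. Such a graph
  without $T_3$ is a star (\<open>no_removable_edge_imp_star\<close>): root the graph at a vertex and look
  at the deepest distance layer. The layer is independent, for an edge inside it could be removed.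
  If its depth is at least two, then a parent $u$ of one of its vertices must have two neighbours of
  degree one in the graph, for otherwise $u$ could be removed together with a child. Those two
  leaves, $u$, and a path of length two that leaves $u$ span a $T_3$; and if no path leaves the
  closed neighbourhood of $u$, then $u$ is the centre of a star. A star without $K_{1,s}$ has at
  most $s$ vertices, and hence deficiency at most $s - 2$ or just one vertex. The bound gives the
  families $\{K_{1,s}, T_3\}$ and $\{K_{1,s}, P_4\}$, since $P_4$ is an induced subgraph of $T_3$,
  and its case $s = 3$ shows that forbidding one connected induced subgraph of the claw $K_{1,3}$
  already bounds the deficiency by one.

  \<^emph>\<open>Lower bounds.\<close> If few vertices meet all edges, the deficiency is large. This applies to
  the star $K_{1,d+1}$, to a complete graph with two leaves attached to each vertex, and to a
  caterpillar whose vertices of degree three are pairwise nonadjacent. One member of a pair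
  $\{H_1, H_2\}$ in $d$-B-def must embed into $K_{1,d+1}$, so it is a star $K_{1,s}$ with
  $s \le d + 1$, and $s \ge 4$ by minimality. The other two graphs contain no $K_{1,4}$, so the
  second member embeds into both. A connected graph embedding into both embeds into $T_3$
  (\<open>embeds_T3_if_embeds_clique_fringe_caterpillar\<close>), and the connected induced subgraphs of
  $T_3$ other than $T_3$ and $P_4$ embed into the claw, which minimality excludes. Conversely the
  caterpillars show that $K_{1,s}$ alone does not suffice, and the stars that $T_3$ or $P_4$ alone
  does not.
\<close>

section \<open>Connectivity and distance inside a vertex set\<close>

definition conn_set :: "'a rel \<Rightarrow> 'a set \<Rightarrow> bool" where
  "conn_set E W \<longleftrightarrow> W \<noteq> {} \<and> (\<forall>x\<in>W. \<forall>y\<in>W. (x, y) \<in> (E \<inter> W \<times> W)\<^sup>*)"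

text \<open>
  Following the descending neighbours leads from every vertex to the root.
\<close>

lemma conn_set_descending:
  fixes f :: "'a \<Rightarrow> nat"
  assumes "sym E" "r \<in> W"
    and step: "\<And>v. v \<in> W \<Longrightarrow> v \<noteq> r \<Longrightarrow> \<exists>u\<in>W. (v, u) \<in> E \<and> f u < f v"
  shows "conn_set E W"
proof -
  let ?R = "E \<inter> W \<times> W"
  have to_r: "(v, r) \<in> ?R\<^sup>*" if "v \<in> W" for v
    using that
  proof (induction "f v" arbitrary: v rule: less_induct)
    case less
    show ?case
    proof (cases "v = r")
      case False
      then obtain u where "u \<in> W" "(v, u) \<in> E" "f u < f v" using step less.prems by blast
      with less show ?thesis by (meson IntI SigmaI converse_rtrancl_into_rtrancl)
    qed simp
  qed
  have "sym ?R" using \<open>sym E\<close> by (auto simp: sym_def)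
  then have "sym (?R\<^sup>*)" by (rule sym_rtrancl)
  then have "(x, y) \<in> ?R\<^sup>*" if "x \<in> W" "y \<in> W" for x y
    using to_r[OF that(1)] to_r[OF that(2)] by (meson rtrancl_trans symD)
  then show ?thesis using \<open>r \<in> W\<close> by (auto simp: conn_set_def)
qed

lemma conn_set_cut:
  assumes "conn_set E W" "X \<subset> W" "X \<noteq> {}"
  obtains x y where "x \<in> X" "y \<in> W - X" "(x, y) \<in> E"
proof -
  obtain a b where a: "a \<in> X" "a \<in> W" and b: "b \<in> W" "b \<notin> X" using assms by blast
  have "(a, b) \<in> (E \<inter> W \<times> W)\<^sup>*" using assms a b by (auto simp: conn_set_def)
  then have "b \<notin> X \<longrightarrow> (\<exists>x\<in>X. \<exists>y\<in>W - X. (x, y) \<in> E)"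
    by induction (use a in auto)
  then show thesis using b that by blast
qed

lemma conn_set_distance:
  assumes "conn_set E W" "r \<in> W"
  obtains f :: "'a \<Rightarrow> nat" where "f r = 0"
    "\<And>v. v \<in> W \<Longrightarrow> v \<noteq> r \<Longrightarrow> \<exists>u\<in>W. (u, v) \<in> E \<and> f v = Suc (f u)"
    "\<And>u v. u \<in> W \<Longrightarrow> v \<in> W \<Longrightarrow> (u, v) \<in> E \<Longrightarrow> f v \<le> Suc (f u)"
proof -
  let ?R = "E \<inter> W \<times> W"
  define f where "f v = (LEAST n. (r, v) \<in> ?R ^^ n)" for v
  have reach: "(r, v) \<in> ?R ^^ f v" if v: "v \<in> W" for v
  proof -
    have "\<exists>n. (r, v) \<in> ?R ^^ n" using assms v by (auto simp: conn_set_def rtrancl_power)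
    then show ?thesis unfolding f_def by (rule LeastI_ex)
  qed
  have least: "f v \<le> n" if "(r, v) \<in> ?R ^^ n" for v n
    unfolding f_def using that by (rule Least_le)
  have up: "f v \<le> Suc (f u)" if "u \<in> W" "v \<in> W" "(u, v) \<in> E" for u v
    using that reach[of u] by (intro least) auto
  show thesis
  proof
    show "f r = 0" using least[of r 0] by simp
    show "\<exists>u\<in>W. (u, v) \<in> E \<and> f v = Suc (f u)" if v: "v \<in> W" "v \<noteq> r" for v
    proof (cases "f v")
      case 0
      then show ?thesis using reach[of v] v by simp
    next
      case (Suc n)
      with reach[of v] v obtain u where u: "(r, u) \<in> ?R ^^ n" "(u, v) \<in> ?R" by auto
      then have "f u \<le> n" "f v \<le> Suc (f u)" using least up by auto
      with Suc u show ?thesis by auto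
    qed
  qed (fact up)
qed

section \<open>Connected graphs without a removable edge\<close>

definition removable_edge :: "'a rel \<Rightarrow> 'a set \<Rightarrow> bool" where
  "removable_edge E W \<longleftrightarrow> (\<exists>a\<in>W. \<exists>b\<in>W. (a, b) \<in> E \<and> conn_set E (W - {a, b}))"

text \<open>
  The pattern is $T_3$ with centre \<open>c\<close>, leaves \<open>p\<close> and \<open>q\<close>, and long leg
  \<open>c\<close>, \<open>b\<close>, \<open>a\<close>.
\<close>

definition fork_in :: "'a rel \<Rightarrow> 'a set \<Rightarrow> bool" where
  "fork_in E W \<longleftrightarrow> (\<exists>a b c p q. {a, b, c, p, q} \<subseteq> W \<and> distinct [a, b, c, p, q] \<and>
     (a, b) \<in> E \<and> (b, c) \<in> E \<and> (c, p) \<in> E \<and> (c, q) \<in> E \<and>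
     (a, c) \<notin> E \<and> (a, p) \<notin> E \<and> (a, q) \<notin> E \<and> (b, p) \<notin> E \<and> (b, q) \<notin> E \<and> (p, q) \<notin> E)"

text \<open>
  An edge avoiding \<open>u\<close> would be removable, since every vertex that remains is still joined to
  \<open>u\<close>.
\<close>

lemma dominated_independent:
  assumes "sym E" "u \<in> W" "\<not> removable_edge E W"
    and dom: "\<And>v. v \<in> W \<Longrightarrow> v \<noteq> u \<Longrightarrow> (u, v) \<in> E"
    and xy: "x \<in> W" "y \<in> W" "x \<noteq> u" "y \<noteq> u"
  shows "(x, y) \<notin> E"
proof
  assume e: "(x, y) \<in> E"
  have "conn_set E (W - {x, y})"
    by (rule conn_set_descending[where r = u and f = "\<lambda>v. if v = u then 0 else 1"])
      (use assms in \<open>auto dest: symD\<close>)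
  with e xy assms show False by (auto simp: removable_edge_def)
qed

text \<open>
  This is the heart of the upper bound. The hypothesis on \<open>z\<close> says that the deepest distance
  layer around \<open>r\<close> has depth at least two. Vertices other than \<open>r\<close> can be deleted without
  losing connectivity as long as every vertex that remains keeps a neighbour one layer closer to
  \<open>r\<close>. So the deepest layer is independent, and the deletion of a parent \<open>u\<close>
  together with one child can fail only because another child has no neighbour but \<open>u\<close>. That
  child can play the part of the deleted one, which yields a second leaf at \<open>u\<close>.
\<close>

lemma two_leaves_at_common_neighbour:
  assumes "finite W" "sym E" "conn_set E W" "\<not> removable_edge E W"
    and "r \<in> W" "z \<in> W" "z \<noteq> r" "(r, z) \<notin> E"
  obtains u p q where "u \<in> W" "p \<in> W" "q \<in> W" "p \<noteq> q"
    "\<And>x. x \<in> W \<Longrightarrow> (x, p) \<in> E \<longleftrightarrow> x = u" "\<And>x. x \<in> W \<Longrightarrow> (x, q) \<in> E \<longleftrightarrow> x = u"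
proof -
  obtain f :: "'a \<Rightarrow> nat" where f: "f r = 0"
      "\<And>v. v \<in> W \<Longrightarrow> v \<noteq> r \<Longrightarrow> \<exists>u\<in>W. (u, v) \<in> E \<and> f v = Suc (f u)"
      "\<And>u v. u \<in> W \<Longrightarrow> v \<in> W \<Longrightarrow> (u, v) \<in> E \<Longrightarrow> f v \<le> Suc (f u)"
    using conn_set_distance[OF \<open>conn_set E W\<close> \<open>r \<in> W\<close>] by metis
  have symE: "(b, a) \<in> E" if "(a, b) \<in> E" for a b using that \<open>sym E\<close> by (auto dest: symD)
  define L where "L = Max (f ` W)"
  have le_L: "f v \<le> L" if "v \<in> W" for v using that \<open>finite W\<close> by (simp add: L_def)
  have "f z \<noteq> 0" using f(2)[of z] \<open>z \<in> W\<close> \<open>z \<noteq> r\<close> by auto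
  moreover have "f z \<noteq> 1"
  proof
    assume "f z = 1"
    then obtain y where y: "y \<in> W" "(y, z) \<in> E" "f y = 0"
      using f(2)[of z] \<open>z \<in> W\<close> \<open>z \<noteq> r\<close> by auto
    then have "y = r" using f(2)[of y] by fastforce
    with y \<open>(r, z) \<notin> E\<close> show False by simp
  qed
  ultimately have "2 \<le> L" using le_L[OF \<open>z \<in> W\<close>] by linarith
  have last_independent: "(x, y) \<notin> E" if "x \<in> W" "y \<in> W" "f x = L" "f y = L" for x y
  proof
    assume e: "(x, y) \<in> E"
    have "conn_set E (W - {x, y})"
    proof (rule conn_set_descending[OF \<open>sym E\<close>, where r = r and f = f])
      show "r \<in> W - {x, y}" using \<open>r \<in> W\<close> \<open>2 \<le> L\<close> that f(1) by auto
      fix v assume v: "v \<in> W - {x, y}" "v \<noteq> r"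
      then obtain t where t: "t \<in> W" "(t, v) \<in> E" "f v = Suc (f t)" using f(2) by blast
      then have "f t < L" using le_L[of v] v by simp
      then show "\<exists>t\<in>W - {x, y}. (v, t) \<in> E \<and> f t < f v" using t that symE by force
    qed
    with e that assms show False by (auto simp: removable_edge_def)
  qed
  have another: "\<exists>v\<in>W. v \<noteq> w \<and> f v = L \<and> (\<forall>x\<in>W. (x, v) \<in> E \<longleftrightarrow> x = u)"
    if u: "u \<in> W" "Suc (f u) = L" and w: "w \<in> W" "f w = L" "(u, w) \<in> E" for u w
  proof (rule ccontr)
    assume neg: "\<not> ?thesis"
    have "conn_set E (W - {u, w})"
    proof (rule conn_set_descending[OF \<open>sym E\<close>, where r = r and f = f])
      show "r \<in> W - {u, w}" using \<open>r \<in> W\<close> \<open>2 \<le> L\<close> u w f(1) by auto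
      fix v assume v: "v \<in> W - {u, w}" "v \<noteq> r"
      show "\<exists>t\<in>W - {u, w}. (v, t) \<in> E \<and> f t < f v"
      proof (rule ccontr)
        assume no: "\<not> ?thesis"
        obtain t where t: "t \<in> W" "(t, v) \<in> E" "f v = Suc (f t)" using f(2) v by blast
        have "t \<noteq> w" using t le_L[of v] v w by auto
        then have "t = u" using no t symE by force
        then have fv: "f v = L" using t u by simp
        have "x = u" if x: "x \<in> W" "(x, v) \<in> E" for x
        proof (rule ccontr)
          assume "x \<noteq> u"
          have "f x \<noteq> L" using last_independent[of x v] x v fv by auto
          then have "f x < f v" using le_L[OF x(1)] fv by simp
          moreover have "x \<noteq> w" using \<open>f x \<noteq> L\<close> w by auto
          ultimately show False using no x \<open>x \<noteq> u\<close> symE by blast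
        qed
        then show False using neg v fv t \<open>t = u\<close> by blast
      qed
    qed
    with u w assms show False by (auto simp: removable_edge_def)
  qed
  \<comment> \<open>The first leaf comes from an arbitrary child \<open>w\<close>, the second from deleting the first.\<close>
  have "L \<in> f ` W" unfolding L_def using \<open>finite W\<close> \<open>r \<in> W\<close> by (intro Max_in) auto
  then obtain w where w: "w \<in> W" "f w = L" by auto
  then have "w \<noteq> r" using f(1) \<open>2 \<le> L\<close> by auto
  then obtain u where u: "u \<in> W" "(u, w) \<in> E" "L = Suc (f u)" using f(2) w by metis
  obtain p where p: "p \<in> W" "f p = L" "\<forall>x\<in>W. (x, p) \<in> E \<longleftrightarrow> x = u"
    using another[of u w] u w by metis
  obtain q where q: "q \<in> W" "q \<noteq> p" "\<forall>x\<in>W. (x, q) \<in> E \<longleftrightarrow> x = u"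
    using another[of u p] u p by metis
  show thesis using that[of u p q] u p q by auto
qed

lemma no_removable_edge_imp_star:
  assumes "finite W" "sym E" "irrefl E" "conn_set E W"
    and "\<not> removable_edge E W" "\<not> fork_in E W"
  obtains u where "u \<in> W" "\<And>v. v \<in> W \<Longrightarrow> v \<noteq> u \<Longrightarrow> (u, v) \<in> E"
    "\<And>x y. x \<in> W \<Longrightarrow> y \<in> W \<Longrightarrow> x \<noteq> u \<Longrightarrow> y \<noteq> u \<Longrightarrow> (x, y) \<notin> E"
proof -
  have symE: "(b, a) \<in> E" if "(a, b) \<in> E" for a b using that \<open>sym E\<close> by (auto dest: symD)
  have irr: "(a, a) \<notin> E" for a using \<open>irrefl E\<close> by (auto simp: irrefl_def)
  have "\<exists>u\<in>W. \<forall>v\<in>W. v \<noteq> u \<longrightarrow> (u, v) \<in> E"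
  proof (rule ccontr)
    assume neg: "\<not> ?thesis"
    obtain r where r: "r \<in> W" using \<open>conn_set E W\<close> by (auto simp: conn_set_def)
    with neg obtain z where z: "z \<in> W" "z \<noteq> r" "(r, z) \<notin> E" by blast
    obtain u p q where u: "u \<in> W" and pq: "p \<in> W" "q \<in> W" "p \<noteq> q"
      and p: "\<And>x. x \<in> W \<Longrightarrow> (x, p) \<in> E \<longleftrightarrow> x = u"
      and q: "\<And>x. x \<in> W \<Longrightarrow> (x, q) \<in> E \<longleftrightarrow> x = u"
      using two_leaves_at_common_neighbour[OF assms(1,2,4,5) r z] by metis
    \<comment> \<open>An edge \<open>b\<close>--\<open>a\<close> leaving the closed neighbourhood of \<open>u\<close> provides the long leg.\<close>
    let ?X = "{x\<in>W. x = u \<or> (u, x) \<in> E}"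
    have "?X \<subset> W" "?X \<noteq> {}" using neg u by auto
    then obtain b a where b: "b \<in> ?X" and a: "a \<in> W - ?X" and e: "(b, a) \<in> E"
      by (rule conn_set_cut[OF \<open>conn_set E W\<close>])
    then have bu: "b \<noteq> u" "(u, b) \<in> E" by auto
    have aW: "a \<in> W" "a \<noteq> u" "(u, a) \<notin> E" and bW: "b \<in> W" using a b by auto
    have edges: "(a, b) \<in> E" "(b, u) \<in> E" "(u, p) \<in> E" "(u, q) \<in> E"
      using e bu(2) p[OF u] q[OF u] symE by auto
    have pq_neq: "p \<noteq> u" "q \<noteq> u" "p \<noteq> a" "q \<noteq> a" using edges(3,4) irr[of u] aW(3) by metis+
    have pqb: "p \<noteq> b" "q \<noteq> b" using p[OF aW(1)] q[OF aW(1)] aW(2) edges(1) by metis+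
    have "a \<noteq> b" using edges(1) irr[of b] by metis
    then have "distinct [a, b, u, p, q]" using aW(2) bu(1) pq_neq pqb pq(3) by auto
    moreover have "(a, u) \<notin> E" using aW(3) symE by blast
    moreover have "(a, p) \<notin> E" "(a, q) \<notin> E" "(b, p) \<notin> E" "(b, q) \<notin> E" "(p, q) \<notin> E"
      using p[OF aW(1)] q[OF aW(1)] p[OF bW] q[OF bW] q[OF pq(1)] aW(2) bu(1) pq_neq(1) by simp_all
    ultimately have "fork_in E W"
      unfolding fork_in_def using edges aW(1) bW u pq(1,2) by blast
    with assms show False by simp
  qed
  then obtain u where u: "u \<in> W" "\<And>v. v \<in> W \<Longrightarrow> v \<noteq> u \<Longrightarrow> (u, v) \<in> E" by blast
  then show thesis
    using that dominated_independent[OF \<open>sym E\<close> _ \<open>\<not> removable_edge E W\<close>] by blast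
qed

definition star_free_in :: "nat \<Rightarrow> 'a rel \<Rightarrow> 'a set \<Rightarrow> bool" where
  "star_free_in s E W \<longleftrightarrow> (\<forall>u\<in>W. \<forall>A. A \<subseteq> W - {u} \<and> (\<forall>v\<in>A. (u, v) \<in> E) \<and>
     (\<forall>x\<in>A. \<forall>y\<in>A. (x, y) \<notin> E) \<longrightarrow> card A < s)"

lemma fork_in_mono: "fork_in E W' \<Longrightarrow> W' \<subseteq> W \<Longrightarrow> fork_in E W"
  unfolding fork_in_def by (meson order_trans)

lemma star_free_in_mono: "star_free_in s E W \<Longrightarrow> W' \<subseteq> W \<Longrightarrow> star_free_in s E W'"
  unfolding star_free_in_def by (meson Diff_mono order_refl order_trans subsetD)

text \<open>
  Induction on the vertex set: a removable edge is put into the matching, and otherwise the graph is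
  a star with at most \<open>s\<close> vertices. The single vertex has an uncovered vertex and no edge,
  which is where \<open>3 \<le> s\<close> enters.
\<close>

lemma large_matching_exists:
  assumes "sym E" "irrefl E" "3 \<le> s"
    and "finite W" "conn_set E W" "\<not> fork_in E W" "star_free_in s E W"
  shows "\<exists>M. M \<subseteq> {{u, v} | u v. u \<in> W \<and> v \<in> W \<and> (u, v) \<in> E} \<and> disjoint M \<and>
    card W \<le> 2 * card M + (s - 2)"
  using assms(4-7)
proof (induction W rule: finite_psubset_induct)
  case (psubset W)
  show ?case
  proof (cases "removable_edge E W")
    case True
    then obtain a b where ab: "a \<in> W" "b \<in> W" "(a, b) \<in> E" "conn_set E (W - {a, b})"
      by (auto simp: removable_edge_def)
    have neq: "a \<noteq> b" using ab \<open>irrefl E\<close> by (auto simp: irrefl_def)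
    have "\<not> fork_in E (W - {a, b})" "star_free_in s E (W - {a, b})"
      using psubset.prems fork_in_mono star_free_in_mono Diff_subset by metis+
    moreover have "W - {a, b} \<subset> W" using ab by blast
    ultimately have "\<exists>M. M \<subseteq> {{u, v} | u v. u \<in> W - {a, b} \<and> v \<in> W - {a, b} \<and> (u, v) \<in> E} \<and>
        disjoint M \<and> card (W - {a, b}) \<le> 2 * card M + (s - 2)"
      using ab(4) by (intro psubset.IH)
    then obtain M where
        M: "M \<subseteq> {{u, v} | u v. u \<in> W - {a, b} \<and> v \<in> W - {a, b} \<and> (u, v) \<in> E}" "disjoint M"
          "card (W - {a, b}) \<le> 2 * card M + (s - 2)"
      by blast
    have M_sub: "\<Union>M \<subseteq> W - {a, b}" using M(1) by blast
    then have fin: "finite M"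
      using psubset.hyps by (meson finite_Diff finite_UnionD finite_subset)
    have notin: "{a, b} \<notin> M" using M_sub by blast
    have "disjoint (insert {a, b} M)"
      using M(2) M_sub by (auto simp: disjoint_def)
    moreover have "card (insert {a, b} M) = Suc (card M)" using fin notin by simp
    moreover have "card (W - {a, b}) = card W - 2" "card W \<ge> 2"
      using ab neq psubset.hyps card_mono[of W "{a, b}"] by (auto simp: card_Diff_subset)
    moreover have "insert {a, b} M \<subseteq> {{u, v} | u v. u \<in> W \<and> v \<in> W \<and> (u, v) \<in> E}"
      using M(1) ab(1-3) by blast
    ultimately show ?thesis using M(3) by (intro exI[of _ "insert {a, b} M"]) linarith
  next
    case False
    obtain u where u: "u \<in> W" "\<And>v. v \<in> W \<Longrightarrow> v \<noteq> u \<Longrightarrow> (u, v) \<in> E"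
        "\<And>x y. x \<in> W \<Longrightarrow> y \<in> W \<Longrightarrow> x \<noteq> u \<Longrightarrow> y \<noteq> u \<Longrightarrow> (x, y) \<notin> E"
      using no_removable_edge_imp_star[OF psubset.hyps assms(1,2) psubset.prems(1) False
          psubset.prems(2)] by blast
    have "card (W - {u}) < s"
      using psubset.prems(3) u unfolding star_free_in_def by (metis DiffD1 DiffD2 insertI1 order_refl)
    then have "card W \<le> s" using u(1) psubset.hyps by simp
    show ?thesis
    proof (cases "W = {u}")
      case True
      then show ?thesis using \<open>3 \<le> s\<close> by (intro exI[of _ "{}"]) auto
    next
      case False
      then obtain v where v: "v \<in> W" "v \<noteq> u" using u(1) by blast
      then have "{{u, v}} \<subseteq> {{u, v} | u v. u \<in> W \<and> v \<in> W \<and> (u, v) \<in> E}"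
        using u(1,2) by blast
      then show ?thesis using \<open>card W \<le> s\<close> \<open>3 \<le> s\<close>
        by (intro exI[of _ "{{u, v}}"]) (simp add: disjoint_def)
    qed
  qed
qed

section \<open>Induced copies as embeddings\<close>

definition embeds :: "'a pair_pre_digraph \<Rightarrow> 'b pair_pre_digraph \<Rightarrow> bool" where
  "embeds H G \<longleftrightarrow> (\<exists>f. inj_on f (pverts H) \<and> f ` pverts H \<subseteq> pverts G \<and>
     (\<forall>x\<in>pverts H. \<forall>y\<in>pverts H. (x, y) \<in> parcs H \<longleftrightarrow> (f x, f y) \<in> parcs G))"

lemma embedsI:
  assumes "inj_on f (pverts H)" "\<And>x. x \<in> pverts H \<Longrightarrow> f x \<in> pverts G"
    "\<And>x y. x \<in> pverts H \<Longrightarrow> y \<in> pverts H \<Longrightarrow> (x, y) \<in> parcs H \<longleftrightarrow> (f x, f y) \<in> parcs G"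
  shows "embeds H G"
  using assms unfolding embeds_def by blast

lemma embeds_refl: "embeds G G"
  by (rule embedsI[where f = id]) auto

lemma embeds_trans:
  assumes "embeds F G" "embeds G H"
  shows "embeds F H"
proof -
  obtain f where f: "inj_on f (pverts F)" "f ` pverts F \<subseteq> pverts G"
      "\<And>x y. x \<in> pverts F \<Longrightarrow> y \<in> pverts F \<Longrightarrow> (x, y) \<in> parcs F \<longleftrightarrow> (f x, f y) \<in> parcs G"
    using assms(1) unfolding embeds_def by blast
  obtain g where g: "inj_on g (pverts G)" "g ` pverts G \<subseteq> pverts H"
      "\<And>x y. x \<in> pverts G \<Longrightarrow> y \<in> pverts G \<Longrightarrow> (x, y) \<in> parcs G \<longleftrightarrow> (g x, g y) \<in> parcs H"
    using assms(2) unfolding embeds_def by blast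
  show ?thesis
  proof (rule embedsI[where f = "g \<circ> f"])
    show "inj_on (g \<circ> f) (pverts F)"
      using f g by (meson comp_inj_on inj_on_subset)
  qed (use f g in \<open>auto simp: image_subset_iff\<close>)
qed

text \<open>
  An injection between finite sets of the same size is onto.
\<close>

lemma digraph_iso_if_embeds_card_le:
  assumes "embeds H G" "pair_graph H" "pair_graph G" "card (pverts G) \<le> card (pverts H)"
  shows "digraph_iso (with_proj H) (with_proj G)"
proof -
  interpret H: pair_graph H by fact
  interpret G: pair_graph G by fact
  obtain f where f: "inj_on f (pverts H)" "f ` pverts H \<subseteq> pverts G"
      "\<And>x y. x \<in> pverts H \<Longrightarrow> y \<in> pverts H \<Longrightarrow> (x, y) \<in> parcs H \<longleftrightarrow> (f x, f y) \<in> parcs G"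
    using assms(1) unfolding embeds_def by blast
  have im: "f ` pverts H = pverts G"
    using f assms(4) G.pair_finite_verts by (metis card_image card_seteq)
  let ?h = "\<lparr>iso_verts = f, iso_arcs = map_prod f f, iso_head = snd, iso_tail = fst\<rparr>"
  have "inj_on (map_prod f f) (parcs H)"
    by (rule inj_on_subset[OF map_prod_inj_on[OF f(1) f(1)]])
      (auto dest: H.in_arcsD1 H.in_arcsD2)
  then have "H.digraph_isomorphism ?h"
    unfolding H.digraph_isomorphism_def using f(1) H.wf_digraph_axioms by auto
  moreover have "map_prod f f ` parcs H = parcs G"
  proof
    show "map_prod f f ` parcs H \<subseteq> parcs G"
      using f(3) by (auto dest: H.in_arcsD1 H.in_arcsD2)
    show "parcs G \<subseteq> map_prod f f ` parcs H"
    proof (rule subrelI)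
      fix x y assume xy: "(x, y) \<in> parcs G"
      then obtain a b where "a \<in> pverts H" "b \<in> pverts H" "x = f a" "y = f b"
        using im G.in_arcsD1 G.in_arcsD2 by (metis imageE)
      with xy f(3) show "(x, y) \<in> map_prod f f ` parcs H" by (auto intro!: rev_image_eqI)
    qed
  qed
  then have "with_proj G = app_iso ?h (with_proj H)"
    using im by (simp add: with_proj_def app_iso_def)
  ultimately show ?thesis unfolding digraph_iso_def by blast
qed

text \<open>
  Subgraphs share the maps from arcs to their ends with the ambient graph, so every arc of an
  induced copy is the pair of its ends, even though isomorphisms may rename arcs freely.
\<close>

lemma embeds_iff_induced_copy:
  assumes "pair_graph H" "pair_graph G"
  shows "embeds H G \<longleftrightarrow> (\<exists>F. induced_subgraph F (with_proj G) \<and> digraph_iso (with_proj H) F)"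
proof
  interpret H: pair_graph H by fact
  interpret G: pair_graph G by fact
  {
    assume "embeds H G"
    then obtain f where f: "inj_on f (pverts H)" "f ` pverts H \<subseteq> pverts G"
        "\<And>x y. x \<in> pverts H \<Longrightarrow> y \<in> pverts H \<Longrightarrow> (x, y) \<in> parcs H \<longleftrightarrow> (f x, f y) \<in> parcs G"
      unfolding embeds_def by blast
    let ?W = "f ` pverts H"
    let ?F = "\<lparr>pverts = ?W, parcs = parcs G \<inter> ?W \<times> ?W\<rparr>"
    have fin: "finite ?W" using H.pair_finite_verts by simp
    have F: "pair_graph ?F"
      using fin G.pair_finite_arcs G.pair_no_loops G.pair_sym_arcs
      by unfold_locales (auto simp: symmetric_def sym_def)
    interpret F: pair_graph ?F by fact
    have "embeds H ?F" by (rule embedsI[where f = f]) (use f in auto)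
    then have "digraph_iso (with_proj H) (with_proj ?F)"
      using f(1) by (intro digraph_iso_if_embeds_card_le[OF _ \<open>pair_graph H\<close> F]) (auto simp: card_image)
    moreover have "induced_subgraph (with_proj ?F) (with_proj G)"
      unfolding induced_subgraph_def subgraph_def
      using f(2) G.wf_digraph_axioms F.wf_digraph_axioms by auto
    ultimately show "\<exists>F. induced_subgraph F (with_proj G) \<and> digraph_iso (with_proj H) F" by blast
  }
  assume "\<exists>F. induced_subgraph F (with_proj G) \<and> digraph_iso (with_proj H) F"
  then obtain h where h: "H.digraph_isomorphism h"
    and ind: "induced_subgraph (app_iso h (with_proj H)) (with_proj G)"
    unfolding digraph_iso_def by blast
  have ht: "iso_tail h = fst" "iso_head h = snd"
    using ind by (auto simp: induced_subgraph_def subgraph_def compatible_def)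
  have arcs: "iso_arcs h ` parcs H =
      {e \<in> parcs G. fst e \<in> iso_verts h ` pverts H \<and> snd e \<in> iso_verts h ` pverts H}"
    using ind by (auto simp: induced_subgraph_def)
  have arc: "iso_arcs h (x, y) = (iso_verts h x, iso_verts h y)" if "(x, y) \<in> parcs H" for x y
    using h that ht unfolding H.digraph_isomorphism_def by (metis fst_conv prod.collapse snd_conv)
  have inj: "inj_on (iso_verts h) (pverts H)"
    using h unfolding H.digraph_isomorphism_def by simp
  show "embeds H G"
  proof (rule embedsI[where f = "iso_verts h"])
    show "iso_verts h x \<in> pverts G" if "x \<in> pverts H" for x
      using ind that by (auto simp: induced_subgraph_def subgraph_def)
    fix x y assume xy: "x \<in> pverts H" "y \<in> pverts H"
    show "(x, y) \<in> parcs H \<longleftrightarrow> (iso_verts h x, iso_verts h y) \<in> parcs G"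
    proof
      assume "(x, y) \<in> parcs H"
      then have "iso_arcs h (x, y) \<in> iso_arcs h ` parcs H" by (rule imageI)
      then show "(iso_verts h x, iso_verts h y) \<in> parcs G"
        unfolding arcs using arc \<open>(x, y) \<in> parcs H\<close> by simp
    next
      assume "(iso_verts h x, iso_verts h y) \<in> parcs G"
      then have "(iso_verts h x, iso_verts h y) \<in> iso_arcs h ` parcs H"
        unfolding arcs using xy by simp
      then obtain a b where ab: "(a, b) \<in> parcs H"
          "(iso_verts h x, iso_verts h y) = iso_arcs h (a, b)" by auto
      then have "iso_verts h x = iso_verts h a" "iso_verts h y = iso_verts h b" using arc by auto
      then have "x = a" "y = b"
        using inj_onD[OF inj] xy H.in_arcsD1[OF ab(1)] H.in_arcsD2[OF ab(1)] by metis+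
      with ab show "(x, y) \<in> parcs H" by simp
    qed
  qed (fact inj)
qed

lemma digraph_iso_imp_embeds:
  assumes "pair_graph H" "pair_graph G" "digraph_iso (with_proj H) (with_proj G)"
  shows "embeds H G"
proof -
  interpret G: pair_graph G by fact
  have "induced_subgraph (with_proj G) (with_proj G)"
    using G.wf_digraph_axioms by (auto simp: induced_subgraph_def subgraph_def dest: G.in_arcsD1 G.in_arcsD2)
  with assms show ?thesis by (auto simp: embeds_iff_induced_copy)
qed

lemma digraph_iso_card:
  "digraph_iso (with_proj H) (with_proj G) \<Longrightarrow> card (pverts G) = card (pverts H)"
  unfolding digraph_iso_def pre_digraph.digraph_isomorphism_def
  by (metis card_image verts_app_iso with_proj_simps(1))

lemma iso_class_self: "pair_graph H \<Longrightarrow> H \<in> iso_class H"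
  by (simp add: iso_class_def digraph_iso_if_embeds_card_le embeds_refl)

lemma iso_class_eqI:
  assumes "pair_graph H" "pair_graph G" "digraph_iso (with_proj H) (with_proj G)"
  shows "iso_class H = iso_class G"
proof -
  have HG: "embeds H G" using assms by (rule digraph_iso_imp_embeds)
  have card: "card (pverts G) = card (pverts H)" using assms(3) by (rule digraph_iso_card)
  interpret H: pair_graph H by fact
  have "digraph_iso (with_proj G) (with_proj H)"
    using assms(3) H.digraph_isomorphism_invI unfolding digraph_iso_def by (metis H.app_iso_inv)
  then have GH: "embeds G H" using assms by (intro digraph_iso_imp_embeds)
  have "digraph_iso (with_proj H) (with_proj K) \<longleftrightarrow> digraph_iso (with_proj G) (with_proj K)"
    if "pair_graph K" for K :: "nat pair_pre_digraph"
    using that assms(1,2) card HG GH digraph_iso_imp_embeds digraph_iso_card embeds_trans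
      digraph_iso_if_embeds_card_le by (metis order_refl)
  then show ?thesis by (auto simp: iso_class_def)
qed

text \<open>
  Embeddings compose, so it does not matter which representative of an isomorphism class is looked
  for.
\<close>

lemma family_free_iff:
  assumes "\<And>H. H \<in> R \<Longrightarrow> pair_graph H" "pair_graph G"
  shows "family_free (iso_class ` R) G \<longleftrightarrow> (\<forall>H\<in>R. \<not> embeds H G)"
proof -
  have "(\<exists>H'\<in>iso_class H. \<exists>F. induced_subgraph F (with_proj G) \<and> digraph_iso (with_proj H') F)
      \<longleftrightarrow> embeds H G" if "H \<in> R" for H
  proof -
    have H: "pair_graph H" using assms that by blast
    have "(\<exists>H'\<in>iso_class H. \<exists>F. induced_subgraph F (with_proj G) \<and> digraph_iso (with_proj H') F)
      \<longleftrightarrow> (\<exists>H'\<in>iso_class H. embeds H' G)"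
      using \<open>pair_graph G\<close> by (intro bex_cong refl) (auto simp: iso_class_def embeds_iff_induced_copy)
    also have "\<dots> \<longleftrightarrow> embeds H G"
    proof
      assume "\<exists>H'\<in>iso_class H. embeds H' G"
      then show "embeds H G" using H digraph_iso_imp_embeds embeds_trans
        unfolding iso_class_def by blast
    qed (use iso_class_self[OF H] in blast)
    finally show ?thesis .
  qed
  then show ?thesis unfolding family_free_def by simp
qed

lemma connected_iff_conn_set:
  assumes "pair_graph G"
  shows "connected (with_proj G) \<longleftrightarrow> conn_set (parcs G) (pverts G)"
proof -
  interpret G: pair_graph G by fact
  have sub: "parcs G \<inter> pverts G \<times> pverts G = parcs G" using G.in_arcsD1 G.in_arcsD2 by auto
  have sym: "symcl (parcs G) = parcs G"
    using G.pair_sym_arcs by (auto simp: symcl_def symmetric_def sym_def)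
  have "(x, y) \<in> rtrancl_on (pverts G) (parcs G) \<longleftrightarrow>
      (x, y) \<in> (parcs G)\<^sup>* \<and> x \<in> pverts G \<and> y \<in> pverts G" for x y
    using G.reachable_conv[of x y] unfolding reachable_def by simp
  then show ?thesis
    unfolding connected_conv conn_set_def using sym sub by auto
qed

section \<open>The matching number\<close>

lemma pair_graph_sym:
  assumes "pair_graph G"
  shows "sym (parcs G)"
proof -
  interpret pair_graph G by fact
  show ?thesis using pair_sym_arcs by (simp add: symmetric_def)
qed

lemma pair_graph_irrefl:
  assumes "pair_graph G"
  shows "irrefl (parcs G)"
proof -
  interpret pair_graph G by fact
  show ?thesis by (rule irreflI) (metis fst_conv snd_conv pair_no_loops)
qed

lemma finite_uedges: "pair_graph G \<Longrightarrow> finite (uedges G)"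
proof -
  assume "pair_graph G"
  then interpret pair_graph G .
  have "uedges G \<subseteq> (\<lambda>(u, v). {u, v}) ` parcs G" unfolding uedges_def by auto
  then show ?thesis by (rule finite_surj[OF pair_finite_arcs])
qed

lemma finite_matching_sizes:
  assumes "pair_graph G"
  shows "finite {card M | M. matching G M}"
proof -
  have "{card M | M. matching G M} \<subseteq> card ` Pow (uedges G)"
    by (auto simp: matching_def)
  then show ?thesis by (rule finite_surj[rotated]) (simp add: finite_uedges[OF assms])
qed

lemma card_le_matching_number:
  assumes "pair_graph G" "matching G M"
  shows "card M \<le> matching_number G"
  unfolding matching_number_def
  using finite_matching_sizes[OF assms(1)] assms(2) by (intro Max_ge) auto

text \<open>
  Choosing from every matching edge a vertex of the cover \<open>C\<close> gives an injection.
\<close>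

lemma matching_number_le_cover:
  assumes "pair_graph G" "finite C" and cover: "\<And>x y. (x, y) \<in> parcs G \<Longrightarrow> x \<in> C \<or> y \<in> C"
  shows "matching_number G \<le> card C"
proof -
  have "{card M | M. matching G M} \<noteq> {}"
    using matching_def[of G "{}"] by (auto simp: disjoint_def)
  then have "matching_number G \<in> {card M | M. matching G M}"
    unfolding matching_number_def using finite_matching_sizes[OF assms(1)] by (intro Max_in)
  then obtain M where M: "matching_number G = card M" "M \<subseteq> uedges G" "disjoint M"
    by (auto simp: matching_def)
  have "\<forall>e\<in>M. \<exists>x. x \<in> e \<inter> C"
  proof
    fix e assume "e \<in> M"
    then obtain x y where "e = {x, y}" "(x, y) \<in> parcs G" using M(2) unfolding uedges_def by blast
    then show "\<exists>x. x \<in> e \<inter> C" using cover[of x y] by blast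
  qed
  then obtain g where g: "\<And>e. e \<in> M \<Longrightarrow> g e \<in> e \<inter> C" by metis
  have "inj_on g M"
  proof (rule inj_onI)
    fix e e' assume e: "e \<in> M" "e' \<in> M" "g e = g e'"
    then have "e \<inter> e' \<noteq> {}" using g[of e] g[of e'] by auto
    then show "e = e'" using e M(3) by (auto simp: disjoint_def)
  qed
  moreover have "g ` M \<subseteq> C" using g by blast
  ultimately show ?thesis using M(1) \<open>finite C\<close> by (simp add: card_inj_on_le)
qed

section \<open>Stars, $P_4$ and $T_3$\<close>

lemma in_parcs_star:
  "(x, y) \<in> parcs (star s) \<longleftrightarrow> x \<le> s \<and> y \<le> s \<and> x \<noteq> y \<and> (x = 0 \<or> y = 0)"
  unfolding star_def symcl_def by (auto simp: image_iff)

lemma in_parcs_path4: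
  "(x, y) \<in> parcs (path_graph 4) \<longleftrightarrow> x < 4 \<and> y < 4 \<and> (y = Suc x \<or> x = Suc y)"
  unfolding path_graph_def symcl_def by (auto simp: image_iff)

lemma parcs_T3:
  "parcs T3 = {(0, 1), (1, 0), (1, 2), (2, 1), (2, 3), (3, 2), (2, 4), (4, 2)}"
proof -
  have "{(i, Suc i) | i. Suc i < 3} = {(0, 1), (1, 2)}"
    by (auto simp: numeral_eq_Suc less_Suc_eq)
  then show ?thesis unfolding T3_def path_graph_def symcl_def by auto
qed

lemma pverts_star: "pverts (star s) = {..s}"
  by (auto simp: star_def)

lemma pverts_path_graph: "pverts (path_graph n) = {..<n}"
  by (simp add: path_graph_def)

lemma pverts_T3: "pverts T3 = {..<5}"
  by (auto simp: T3_def path_graph_def)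

lemma pair_graphI:
  assumes "finite (pverts G)" "parcs G \<subseteq> pverts G \<times> pverts G" "sym (parcs G)" "irrefl (parcs G)"
  shows "pair_graph G"
proof
  show "finite (parcs G)" using assms(1,2) by (meson finite_SigmaI finite_subset)
  show "symmetric (with_proj G)" using assms(3) by (simp add: symmetric_def)
qed (use assms in \<open>auto simp: irrefl_def\<close>)

lemma pair_graph_star: "pair_graph (star s)"
  by (rule pair_graphI) (auto simp: pverts_star in_parcs_star sym_def irrefl_def)

lemma pair_graph_path4: "pair_graph (path_graph 4)"
  by (rule pair_graphI) (auto simp: pverts_path_graph in_parcs_path4 sym_def irrefl_def)

lemma pair_graph_T3: "pair_graph T3"
  by (rule pair_graphI) (auto simp: pverts_T3 parcs_T3 sym_def irrefl_def)

lemma embeds_star_mono: "s \<le> t \<Longrightarrow> embeds (star s) (star t)"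
  by (rule embedsI[where f = id]) (auto simp: pverts_star in_parcs_star)

lemma embeds_star3_T3: "embeds (star 3) T3"
proof (rule embedsI[where f = "\<lambda>x. [2, 1, 3, 4] ! x"])
  have verts: "x \<in> {0, 1, 2, 3}" if "x \<in> pverts (star 3)" for x
    using that by (auto simp: pverts_star)
  show "inj_on (\<lambda>x. [2, 1, 3, 4::nat] ! x) (pverts (star 3))"
    by (rule inj_onI) (simp add: pverts_star nth_eq_iff_index_eq)
  fix x y assume "x \<in> pverts (star 3)" "y \<in> pverts (star 3)"
  from verts[OF this(1)] verts[OF this(2)]
  show "(x, y) \<in> parcs (star 3) \<longleftrightarrow> ([2, 1, 3, 4] ! x, [2, 1, 3, 4] ! y) \<in> parcs T3"
    by (elim insertE emptyE) (simp_all add: in_parcs_star parcs_T3)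
next
  fix x assume "x \<in> pverts (star 3)"
  then have "x \<in> {0, 1, 2, 3}" by (auto simp: pverts_star)
  then show "[2, 1, 3, 4] ! x \<in> pverts T3"
    by (elim insertE emptyE) (simp_all add: pverts_T3)
qed

lemma embeds_path4_T3: "embeds (path_graph 4) T3"
proof (rule embedsI[where f = id])
  fix x y assume "x \<in> pverts (path_graph 4)" "y \<in> pverts (path_graph 4)"
  then have "x \<in> {0, 1, 2, 3}" "y \<in> {0, 1, 2, 3}" by (auto simp: pverts_path_graph)
  then show "(x, y) \<in> parcs (path_graph 4) \<longleftrightarrow> (id x, id y) \<in> parcs T3"
    by (elim insertE emptyE) (simp_all add: in_parcs_path4 parcs_T3)
qed (auto simp: pverts_path_graph pverts_T3)

text \<open>
  The two end edges of the path are disjoint, but all edges of a star share the centre.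
\<close>

lemma not_embeds_path4_star: "\<not> embeds (path_graph 4) (star s)"
proof
  assume "embeds (path_graph 4) (star s)"
  then obtain f where inj: "inj_on f {..<4::nat}"
    and f: "\<And>x y. x < 4 \<Longrightarrow> y < 4 \<Longrightarrow> (x, y) \<in> parcs (path_graph 4) \<longleftrightarrow> (f x, f y) \<in> parcs (star s)"
    unfolding embeds_def by (auto simp: pverts_path_graph)
  have "f 0 = 0 \<or> f 1 = 0" "f 2 = 0 \<or> f 3 = 0"
    using f[of 0 1] f[of 2 3] by (auto simp: in_parcs_path4 in_parcs_star)
  then show False using inj_onD[OF inj, of 0 2] inj_onD[OF inj, of 0 3]
      inj_onD[OF inj, of 1 2] inj_onD[OF inj, of 1 3] by auto
qed

lemma embeds_T3_if_fork_in:
  assumes "pair_graph G" "fork_in (parcs G) (pverts G)"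
  shows "embeds T3 G"
proof -
  have sym: "(y, x) \<in> parcs G \<longleftrightarrow> (x, y) \<in> parcs G" for x y
    using pair_graph_sym[OF assms(1)] by (meson symD)
  have irr: "(x, x) \<notin> parcs G" for x
    using pair_graph_irrefl[OF assms(1)] by (simp add: irrefl_def)
  obtain a b c p q where
    V: "{a, b, c, p, q} \<subseteq> pverts G" "distinct [a, b, c, p, q]"
    and E: "(a, b) \<in> parcs G" "(b, c) \<in> parcs G" "(c, p) \<in> parcs G" "(c, q) \<in> parcs G"
    and N: "(a, c) \<notin> parcs G" "(a, p) \<notin> parcs G" "(a, q) \<notin> parcs G" "(b, p) \<notin> parcs G"
      "(b, q) \<notin> parcs G" "(p, q) \<notin> parcs G"
    using assms(2) unfolding fork_in_def by metis
  have E': "(b, a) \<in> parcs G" "(c, b) \<in> parcs G" "(p, c) \<in> parcs G" "(q, c) \<in> parcs G"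
    and N': "(c, a) \<notin> parcs G" "(p, a) \<notin> parcs G" "(q, a) \<notin> parcs G" "(p, b) \<notin> parcs G"
      "(q, b) \<notin> parcs G" "(q, p) \<notin> parcs G"
    using E N sym by blast+
  let ?f = "\<lambda>x. [a, b, c, p, q] ! x"
  show ?thesis
  proof (rule embedsI[where f = ?f])
    show "inj_on ?f (pverts T3)"
      using V(2) by (intro inj_onI) (simp add: pverts_T3 nth_eq_iff_index_eq)
    show "?f x \<in> pverts G" if "x \<in> pverts T3" for x
      using that V(1) nth_mem[of x "[a, b, c, p, q]"] by (auto simp: pverts_T3 simp del: nth_mem)
    fix x y assume "x \<in> pverts T3" "y \<in> pverts T3"
    then have "x \<in> {0, 1, 2, 3, 4}" "y \<in> {0, 1, 2, 3, 4}" by (auto simp: pverts_T3)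
    then show "(x, y) \<in> parcs T3 \<longleftrightarrow> (?f x, ?f y) \<in> parcs G"
      using E N E' N' irr by (elim insertE emptyE) (simp_all add: parcs_T3)
  qed
qed

lemma star_free_in_if_not_embeds:
  assumes "pair_graph G" "\<not> embeds (star s) G"
  shows "star_free_in s (parcs G) (pverts G)"
proof (rule ccontr)
  interpret pair_graph G by fact
  have irr: "(x, x) \<notin> parcs G" for x
    using pair_graph_irrefl[OF assms(1)] by (simp add: irrefl_def)
  assume "\<not> ?thesis"
  then obtain u A where u: "u \<in> pverts G" "A \<subseteq> pverts G - {u}" "\<And>v. v \<in> A \<Longrightarrow> (u, v) \<in> parcs G"
      "\<And>x y. x \<in> A \<Longrightarrow> y \<in> A \<Longrightarrow> (x, y) \<notin> parcs G" "s \<le> card A"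
    unfolding star_free_in_def by (auto simp: not_less)
  have "finite A" using u(2) pair_finite_verts finite_subset by blast
  then obtain h where h: "h ` {1..s} \<subseteq> A" "inj_on h {1..s}"
    using card_le_inj[of "{1..s}" A] u(5) by auto
  let ?f = "\<lambda>i. if i = 0 then u else h i"
  have hA: "h i \<in> A" if "i \<noteq> 0" "i \<le> s" for i
    using h(1) that by (auto simp: image_subset_iff)
  have hub: "(u, h i) \<in> parcs G" "(h i, u) \<in> parcs G" if "i \<noteq> 0" "i \<le> s" for i
    using u(3) hA[OF that] symD[OF pair_graph_sym[OF assms(1)]] by blast+
  have "embeds (star s) G"
  proof (rule embedsI[where f = ?f])
    show "inj_on ?f (pverts (star s))"
    proof (rule inj_onI)
      fix i j assume "i \<in> pverts (star s)" "j \<in> pverts (star s)" "?f i = ?f j"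
      moreover have "h i \<noteq> u" if "i \<noteq> 0" "i \<le> s" for i using hA[OF that] u(2) by blast
      ultimately show "i = j"
        using inj_onD[OF h(2), of i j] by (auto simp: pverts_star split: if_splits)
    qed
    show "?f i \<in> pverts G" if "i \<in> pverts (star s)" for i
      using that hA[of i] u by (auto simp: pverts_star)
    show "(i, j) \<in> parcs (star s) \<longleftrightarrow> (?f i, ?f j) \<in> parcs G"
      if "i \<in> pverts (star s)" "j \<in> pverts (star s)" for i j
      using that hA hub u(4) irr
      by (cases "i = 0"; cases "j = 0") (simp_all add: pverts_star in_parcs_star)
  qed
  with assms show False by simp
qed

lemma deficiency_le_if_fork_star_free:
  assumes "pair_graph G" "connected (with_proj G)" "3 \<le> s"
    and "\<not> embeds T3 G" "\<not> embeds (star s) G"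
  shows "deficiency G \<le> int s - 2"
proof -
  interpret pair_graph G by fact
  let ?E = "parcs G" and ?V = "pverts G"
  have "sym ?E" "irrefl ?E" using pair_graph_sym pair_graph_irrefl assms(1) by auto
  moreover have "conn_set ?E ?V" using assms connected_iff_conn_set by blast
  moreover have "\<not> fork_in ?E ?V" using assms embeds_T3_if_fork_in by blast
  moreover have "star_free_in s ?E ?V" using assms star_free_in_if_not_embeds by blast
  ultimately obtain M where M: "M \<subseteq> {{u, v} | u v. u \<in> ?V \<and> v \<in> ?V \<and> (u, v) \<in> ?E}"
      "disjoint M" "card ?V \<le> 2 * card M + (s - 2)"
    using large_matching_exists[of ?E s ?V] \<open>3 \<le> s\<close> pair_finite_verts by blast
  from M(1) have "M \<subseteq> uedges G" unfolding uedges_def by blast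
  then have "matching G M" using M(2) by (simp add: matching_def)
  then have "card M \<le> matching_number G" using assms card_le_matching_number by blast
  with M(3) \<open>3 \<le> s\<close> show ?thesis unfolding deficiency_def by linarith
qed

lemma deficiency_ge_cover:
  assumes "pair_graph G" "finite C" "\<And>x y. (x, y) \<in> parcs G \<Longrightarrow> x \<in> C \<or> y \<in> C"
  shows "int (card (pverts G)) - 2 * int (card C) \<le> deficiency G"
  using matching_number_le_cover[OF assms] unfolding deficiency_def by simp

lemma connected_descending:
  fixes G :: "nat pair_pre_digraph"
  assumes "pair_graph G" "0 \<in> pverts G"
    "\<And>v. v \<in> pverts G \<Longrightarrow> v \<noteq> 0 \<Longrightarrow> \<exists>u\<in>pverts G. (v, u) \<in> parcs G \<and> u < v"
  shows "connected (with_proj G)"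
proof -
  have "conn_set (parcs G) (pverts G)"
    by (rule conn_set_descending[OF pair_graph_sym[OF assms(1)] assms(2), where f = "\<lambda>v. v"])
      (rule assms(3))
  then show ?thesis using assms(1) connected_iff_conn_set by blast
qed

lemma connected_star: "connected (with_proj (star s))"
proof (rule connected_descending[OF pair_graph_star])
  fix v assume "v \<in> pverts (star s)" "v \<noteq> 0"
  then show "\<exists>u\<in>pverts (star s). (v, u) \<in> parcs (star s) \<and> u < v"
    by (intro bexI[of _ 0]) (simp_all add: pverts_star in_parcs_star)
qed (simp add: pverts_star)

lemma deficiency_star: "int s - 1 \<le> deficiency (star s)"
  using deficiency_ge_cover[OF pair_graph_star, of "{0}" s] in_parcs_star
  by (simp add: pverts_star)

section \<open>Two families of large deficiency without $K_{1,4}$\<close>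

text \<open>
  A complete graph on \<open>n\<close> vertices with two leaves attached to each of them. The multiples of
  three are the vertices of the clique, and \<open>3 * i + 1\<close> and \<open>3 * i + 2\<close> are the leaves at
  \<open>3 * i\<close>.
\<close>

definition clique_fringe :: "nat \<Rightarrow> nat pair_pre_digraph" where
  "clique_fringe n = \<lparr>pverts = {..<3 * n},
     parcs = {(x, y). x < 3 * n \<and> y < 3 * n \<and> x \<noteq> y \<and>
       (x mod 3 = 0 \<and> y mod 3 = 0 \<or> x div 3 = y div 3 \<and> (x mod 3 = 0 \<or> y mod 3 = 0))}\<rparr>"

text \<open>
  The caterpillar has a hub \<open>h = 3 * i + 1\<close> in each block of three: the path runs through
  \<open>h - 1\<close>, \<open>h\<close> and \<open>h + 2\<close>, where the last vertex is the first one of the next block, and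
  \<open>h + 1\<close> is a leaf at \<open>h\<close>. So only hubs have degree three, and every edge joins a hub to
  a vertex that is not a hub.
\<close>

definition hub_edge :: "nat \<Rightarrow> nat \<Rightarrow> bool" where
  "hub_edge x y \<longleftrightarrow> x mod 3 = 1 \<and> (x = y + 1 \<or> y = x + 1 \<or> y = x + 2)"

definition caterpillar :: "nat \<Rightarrow> nat pair_pre_digraph" where
  "caterpillar n = \<lparr>pverts = {..<3 * n},
     parcs = {(x, y). x < 3 * n \<and> y < 3 * n \<and> (hub_edge x y \<or> hub_edge y x)}\<rparr>"

lemma pverts_clique_fringe: "pverts (clique_fringe n) = {..<3 * n}"
  by (simp add: clique_fringe_def)

lemma in_parcs_clique_fringe:
  "(x, y) \<in> parcs (clique_fringe n) \<longleftrightarrow> x < 3 * n \<and> y < 3 * n \<and> x \<noteq> y \<and>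
     (x mod 3 = 0 \<and> y mod 3 = 0 \<or> x div 3 = y div 3 \<and> (x mod 3 = 0 \<or> y mod 3 = 0))"
  by (simp add: clique_fringe_def)

lemma pverts_caterpillar: "pverts (caterpillar n) = {..<3 * n}"
  by (simp add: caterpillar_def)

lemma in_parcs_caterpillar:
  "(x, y) \<in> parcs (caterpillar n) \<longleftrightarrow> x < 3 * n \<and> y < 3 * n \<and> (hub_edge x y \<or> hub_edge y x)"
  by (simp add: caterpillar_def)

lemma hub_edge_parity: "hub_edge x y \<Longrightarrow> x mod 3 = 1 \<and> y mod 3 \<noteq> 1"
  unfolding hub_edge_def by presburger

lemma pair_graph_clique_fringe: "pair_graph (clique_fringe n)"
  by (rule pair_graphI) (auto simp: clique_fringe_def sym_def irrefl_def)

lemma pair_graph_caterpillar: "pair_graph (caterpillar n)"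
proof (rule pair_graphI)
  show "irrefl (parcs (caterpillar n))"
    by (rule irreflI) (use hub_edge_parity in \<open>auto simp: in_parcs_caterpillar\<close>)
qed (auto simp: caterpillar_def sym_def)

lemma connected_clique_fringe: "0 < n \<Longrightarrow> connected (with_proj (clique_fringe n))"
proof (rule connected_descending[OF pair_graph_clique_fringe])
  fix v assume v: "v \<in> pverts (clique_fringe n)" "v \<noteq> 0"
  show "\<exists>u\<in>pverts (clique_fringe n). (v, u) \<in> parcs (clique_fringe n) \<and> u < v"
  proof (cases "v mod 3 = 0")
    case True
    with v show ?thesis
      by (intro bexI[of _ 0]) (simp_all add: pverts_clique_fringe in_parcs_clique_fringe)
  next
    case False
    then have "v div 3 * 3 < v" using div_mult_mod_eq[of v 3] by linarith
    with v False show ?thesis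
      by (intro bexI[of _ "v div 3 * 3"])
        (simp_all add: pverts_clique_fringe in_parcs_clique_fringe)
  qed
qed (simp add: pverts_clique_fringe)

lemma connected_caterpillar: "0 < n \<Longrightarrow> connected (with_proj (caterpillar n))"
proof (rule connected_descending[OF pair_graph_caterpillar])
  fix v assume v: "v \<in> pverts (caterpillar n)" "v \<noteq> 0"
  have "\<exists>u<v. hub_edge v u \<or> hub_edge u v"
  proof (cases "v mod 3 = 1")
    case True
    then show ?thesis using v(2) by (intro exI[of _ "v - 1"]) (simp add: hub_edge_def)
  next
    case False
    obtain q r where qr: "v = 3 * q + r" "r = 0 \<or> r = 2"
      using False that[of "v div 3" "v mod 3"] by fastforce
    show ?thesis
    proof (cases q)
      case (Suc k)
      then show ?thesis using qr
        by (intro exI[of _ "if r = 0 then 3 * k + 1 else 3 * q + 1"]) (auto simp: hub_edge_def)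
    next
      case 0
      then show ?thesis using qr v(2) by (intro exI[of _ 1]) (auto simp: hub_edge_def)
    qed
  qed
  then show "\<exists>u\<in>pverts (caterpillar n). (v, u) \<in> parcs (caterpillar n) \<and> u < v"
    using v(1) by (auto simp: pverts_caterpillar in_parcs_caterpillar)
qed (simp add: pverts_caterpillar)

lemma deficiency_clique_fringe: "int n \<le> deficiency (clique_fringe n)"
proof -
  let ?C = "(\<lambda>i. 3 * i) ` {..<n}"
  have "x \<in> ?C" if "x < 3 * n" "x mod 3 = 0" for x
    using that by (intro image_eqI[of _ _ "x div 3"]) auto
  then have "int (card (pverts (clique_fringe n))) - 2 * int (card ?C) \<le> deficiency (clique_fringe n)"
    by (intro deficiency_ge_cover[OF pair_graph_clique_fringe])
      (auto simp: in_parcs_clique_fringe)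
  moreover have "card ?C = n" by (simp add: card_image inj_on_def)
  ultimately show ?thesis by (simp add: pverts_clique_fringe)
qed

lemma deficiency_caterpillar: "int n \<le> deficiency (caterpillar n)"
proof -
  let ?C = "(\<lambda>i. 3 * i + 1) ` {..<n}"
  have C: "x \<in> ?C" if "x < 3 * n" "x mod 3 = 1" for x
  proof (rule image_eqI)
    show "x = 3 * (x div 3) + 1" using that by presburger
  qed (use that in auto)
  have "x \<in> ?C \<or> y \<in> ?C" if "(x, y) \<in> parcs (caterpillar n)" for x y
    using that C[of x] C[of y] hub_edge_parity[of x y] hub_edge_parity[of y x]
    unfolding in_parcs_caterpillar by blast
  then have "int (card (pverts (caterpillar n))) - 2 * int (card ?C) \<le> deficiency (caterpillar n)"
    by (intro deficiency_ge_cover[OF pair_graph_caterpillar]) auto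
  moreover have "card ?C = n" by (simp add: card_image inj_on_def)
  ultimately show ?thesis by (simp add: pverts_caterpillar)
qed

lemma finite_neighbours: "pair_graph G \<Longrightarrow> finite {y. (x, y) \<in> parcs G}"
proof -
  assume "pair_graph G"
  then interpret pair_graph G .
  show ?thesis by (rule finite_subset[OF _ pair_finite_verts]) (auto dest: in_arcsD2)
qed

text \<open>
  A vertex \<open>3 * i\<close> lies between the hubs \<open>3 * i - 2\<close> and \<open>3 * i + 1\<close>.
\<close>

lemma caterpillar_neighbours:
  "card {y. (x, y) \<in> parcs (caterpillar n)} \<le> (if x mod 3 = 1 then 3 else 2)"
proof (cases "x mod 3 = 1")
  case True
  then have "{y. (x, y) \<in> parcs (caterpillar n)} \<subseteq> {x - 1, x + 1, x + 2}"
    using hub_edge_parity by (auto simp: in_parcs_caterpillar hub_edge_def)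
  then have "card {y. (x, y) \<in> parcs (caterpillar n)} \<le> card {x - 1, x + 1, x + 2}"
    by (intro card_mono) auto
  also have "\<dots> \<le> 3" by (simp add: card_insert_if)
  finally show ?thesis using True by simp
next
  case False
  let ?N = "if x mod 3 = 0 then {x + 1, x - 2} else {x - 1}"
  have "{y. (x, y) \<in> parcs (caterpillar n)} \<subseteq> ?N"
  proof
    fix y assume "y \<in> {y. (x, y) \<in> parcs (caterpillar n)}"
    then have y: "y mod 3 = 1" "y = x + 1 \<or> x = y + 1 \<or> x = y + 2"
      using False by (auto simp: in_parcs_caterpillar hub_edge_def)
    have "(y + 1) mod 3 = 2" "(y + 2) mod 3 = 0" "x mod 3 \<noteq> 0 \<Longrightarrow> (x + 1) mod 3 \<noteq> 1"
      using y(1) by presburger+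
    with y show "y \<in> ?N" by auto
  qed
  then have "card {y. (x, y) \<in> parcs (caterpillar n)} \<le> card ?N"
    by (rule card_mono[rotated]) simp
  also have "\<dots> \<le> 2" by (simp add: card_insert_if)
  finally show ?thesis using False by simp
qed

lemma card_neighbours_le_if_inj:
  assumes "pair_graph G" "inj_on f A" "\<And>y. y \<in> A \<Longrightarrow> (c, f y) \<in> parcs G"
  shows "card A \<le> card {y. (c, y) \<in> parcs G}"
  using assms by (intro card_inj_on_le[OF _ _ finite_neighbours]) auto

lemma not_embeds_star4_caterpillar: "\<not> embeds (star 4) (caterpillar n)"
proof
  assume "embeds (star 4) (caterpillar n)"
  then obtain f where f: "inj_on f {..4}"
      "\<And>x y. x \<in> {..4} \<Longrightarrow> y \<in> {..4} \<Longrightarrow> (x, y) \<in> parcs (star 4) \<longleftrightarrow> (f x, f y) \<in> parcs (caterpillar n)"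
    unfolding embeds_def pverts_star by blast
  have "(f 0, f y) \<in> parcs (caterpillar n)" if "y \<in> {1..4}" for y
    using f(2)[of 0 y] that by (simp add: in_parcs_star)
  then have "card {1..4::nat} \<le> card {y. (f 0, y) \<in> parcs (caterpillar n)}"
    using inj_on_subset[OF f(1), of "{1..4}"]
    by (intro card_neighbours_le_if_inj[OF pair_graph_caterpillar]) auto
  then show False using caterpillar_neighbours[of "f 0" n] by (auto split: if_splits)
qed

text \<open>
  Four independent neighbours of one vertex would have different residues modulo three: two
  neighbours in the clique are adjacent, and a neighbour outside the clique lies in the block of
  the centre, so that its residue determines it.
\<close>

lemma not_embeds_star4_clique_fringe: "\<not> embeds (star 4) (clique_fringe n)"
proof
  assume "embeds (star 4) (clique_fringe n)"
  then obtain f where inj: "inj_on f {..4}" and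
      f: "\<And>x y. x \<in> {..4} \<Longrightarrow> y \<in> {..4} \<Longrightarrow> (x, y) \<in> parcs (star 4) \<longleftrightarrow> (f x, f y) \<in> parcs (clique_fringe n)"
    unfolding embeds_def pverts_star by blast
  have "inj_on (\<lambda>i. f i mod 3) {1..4}"
  proof (rule inj_onI)
    fix i j :: nat assume ij: "i \<in> {1..4}" "j \<in> {1..4}" "f i mod 3 = f j mod 3"
    have adj: "(f 0, f i) \<in> parcs (clique_fringe n)" "(f 0, f j) \<in> parcs (clique_fringe n)"
      using f[of 0 i] f[of 0 j] ij by (auto simp: in_parcs_star)
    have nadj: "(f i, f j) \<notin> parcs (clique_fringe n)"
      using f[of i j] ij by (auto simp: in_parcs_star)
    have "f i = f j"
    proof (cases "f i mod 3 = 0")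
      case True
      with adj nadj ij(3) show ?thesis by (auto simp: in_parcs_clique_fringe)
    next
      case False
      then have "f i div 3 = f j div 3" using adj ij(3) by (auto simp: in_parcs_clique_fringe)
      with ij(3) show ?thesis by (metis div_mult_mod_eq)
    qed
    then show "i = j" using inj_onD[OF inj, of i j] ij by auto
  qed
  then have "card {1..4::nat} \<le> card {..<3::nat}"
    by (rule card_inj_on_le) auto
  then show False by simp
qed

text \<open>
  The edge from \<open>x\<close> to \<open>y\<close> becomes the edge from 1 to 2 in \<^const>\<open>T3\<close>, the set
  \<open>A\<close> goes to the end 0 of the long leg, and \<open>B\<close> goes to the leaves 3 and 4.
\<close>

lemma embeds_T3_if_double_star:
  assumes H: "pair_graph H" "(x, y) \<in> parcs H"
    and V: "pverts H = {x, y} \<union> A \<union> B" "A \<inter> B = {}" "x \<notin> A \<union> B" "y \<notin> A \<union> B"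
    and A: "\<And>a. a \<in> A \<Longrightarrow> (x, a) \<in> parcs H \<and> (y, a) \<notin> parcs H" "card A \<le> 1"
    and B: "\<And>b. b \<in> B \<Longrightarrow> (y, b) \<in> parcs H \<and> (x, b) \<notin> parcs H" "card B \<le> 2"
    and indep: "\<And>u v. u \<in> A \<union> B \<Longrightarrow> v \<in> A \<union> B \<Longrightarrow> (u, v) \<notin> parcs H"
  shows "embeds H T3"
proof -
  interpret pair_graph H by fact
  have sym: "(v, u) \<in> parcs H \<longleftrightarrow> (u, v) \<in> parcs H" for u v
    using pair_graph_sym[OF H(1)] by (meson symD)
  have irr: "(v, v) \<notin> parcs H" for v
    using pair_graph_irrefl[OF H(1)] by (simp add: irrefl_def)
  have fin: "finite A" "finite B" using V(1) pair_finite_verts by simp_all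
  have A_le: "a = a'" if "a \<in> A" "a' \<in> A" for a a'
    using that A(2) fin by (metis card_le_Suc0_iff_eq One_nat_def)
  have "card B \<le> card {3, 4::nat}" using B(2) by simp
  then obtain h where h: "h ` B \<subseteq> {3, 4::nat}" "inj_on h B"
    using card_le_inj[OF fin(2), of "{3, 4::nat}"] by auto
  have hB: "h b = 3 \<or> h b = 4" if "b \<in> B" for b using h(1) that by blast
  let ?f = "\<lambda>v. if v = y then 2 else if v = x then 1 else if v \<in> B then h v else 0"
  have xy: "x \<noteq> y" using H(2) irr by auto
  have adj: "(x, y) \<in> parcs H" "(y, x) \<in> parcs H"
      "a \<in> A \<Longrightarrow> (x, a) \<in> parcs H" "a \<in> A \<Longrightarrow> (a, x) \<in> parcs H"
      "a \<in> A \<Longrightarrow> (y, a) \<notin> parcs H" "a \<in> A \<Longrightarrow> (a, y) \<notin> parcs H"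
      "b \<in> B \<Longrightarrow> (y, b) \<in> parcs H" "b \<in> B \<Longrightarrow> (b, y) \<in> parcs H"
      "b \<in> B \<Longrightarrow> (x, b) \<notin> parcs H" "b \<in> B \<Longrightarrow> (b, x) \<notin> parcs H"
      "u \<in> A \<Longrightarrow> v \<in> A \<Longrightarrow> (u, v) \<notin> parcs H" "u \<in> A \<Longrightarrow> v \<in> B \<Longrightarrow> (u, v) \<notin> parcs H"
      "u \<in> B \<Longrightarrow> v \<in> A \<Longrightarrow> (u, v) \<notin> parcs H" "u \<in> B \<Longrightarrow> v \<in> B \<Longrightarrow> (u, v) \<notin> parcs H"
    for a b u v
    using H(2) A(1) B(1) indep sym by blast+
  have cases: "v = x \<or> v = y \<or> v \<in> A \<and> v \<notin> B \<and> v \<noteq> x \<and> v \<noteq> y \<or> v \<in> B \<and> v \<noteq> x \<and> v \<noteq> y"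
    if "v \<in> pverts H" for v using that V by auto
  show ?thesis
  proof (rule embedsI[where f = ?f])
    show "inj_on ?f (pverts H)"
    proof (rule inj_onI)
      fix u v assume uv: "u \<in> pverts H" "v \<in> pverts H" "?f u = ?f v"
      from cases[OF uv(1)] cases[OF uv(2)] uv(3) show "u = v"
        using xy hB[of u] hB[of v] A_le[of u v] inj_onD[OF h(2), of u v] by (auto split: if_splits)
    qed
    show "?f v \<in> pverts T3" if "v \<in> pverts H" for v
      using cases[OF that] hB[of v] by (auto simp: pverts_T3)
    fix u v assume uv: "u \<in> pverts H" "v \<in> pverts H"
    show "(u, v) \<in> parcs H \<longleftrightarrow> (?f u, ?f v) \<in> parcs T3"
      using cases[OF uv(1)] cases[OF uv(2)] hB[of u] hB[of v]
      by (elim disjE) (simp_all add: parcs_T3 adj irr xy xy[symmetric], auto)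
  qed
qed

section \<open>Graphs that embed into both families\<close>

lemma embeds_singleton:
  assumes "pair_graph H" "pverts H = {v}"
  shows "embeds H (star 0)"
proof -
  have "(v, v) \<notin> parcs H" using pair_graph_irrefl[OF assms(1)] by (simp add: irrefl_def)
  then show ?thesis
    by (intro embedsI[where f = "\<lambda>_. 0"]) (auto simp: assms(2) pverts_star in_parcs_star)
qed

lemma connected_neighbour:
  assumes "pair_graph H" "connected (with_proj H)" "v \<in> pverts H" "pverts H \<noteq> {v}"
  obtains w where "w \<in> pverts H" "(v, w) \<in> parcs H"
proof -
  have "conn_set (parcs H) (pverts H)" using assms connected_iff_conn_set by blast
  then show thesis
    by (rule conn_set_cut[of _ _ "{v}"]) (use assms(3,4) that in auto)
qed

lemma caterpillar_triangle_free:
  assumes "(x, y) \<in> parcs (caterpillar n)" "(y, z) \<in> parcs (caterpillar n)"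
  shows "(x, z) \<notin> parcs (caterpillar n)"
  using assms hub_edge_parity unfolding in_parcs_caterpillar by metis

text \<open>
  The embedding \<open>f\<close> splits the vertices into a clique \<open>K\<close> and sets \<open>P k\<close> of at most two
  leaves at each \<open>k\<close> in \<open>K\<close>. The embedding \<open>g\<close> excludes triangles, so \<open>K\<close> has at
  most two elements, and it excludes that both ends of an edge have degree three, so one of the two
  has at most one leaf. What is left fits into $T_3$.
\<close>

lemma embeds_T3_if_embeds_clique_fringe_caterpillar:
  assumes H: "pair_graph H" "connected (with_proj H)"
    and "embeds H (clique_fringe n)" "embeds H (caterpillar m)"
  shows "embeds H T3"
proof -
  interpret pair_graph H by fact
  let ?V = "pverts H" and ?E = "parcs H"
  have sym: "(v, u) \<in> ?E" if "(u, v) \<in> ?E" for u v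
    using symD[OF pair_graph_sym[OF H(1)] that] .
  have irr: "(v, v) \<notin> ?E" for v
    using pair_graph_irrefl[OF H(1)] by (simp add: irrefl_def)
  have single: "embeds H T3" if "?V = {v}" for v
    using embeds_singleton[OF H(1) that] embeds_star_mono[of 0 3] embeds_star3_T3 embeds_trans
    by blast
  obtain f where f_inj: "inj_on f ?V" and f_edge:
      "\<And>x y. x \<in> ?V \<Longrightarrow> y \<in> ?V \<Longrightarrow> (x, y) \<in> ?E \<longleftrightarrow> (f x, f y) \<in> parcs (clique_fringe n)"
      and f_verts: "\<And>x. x \<in> ?V \<Longrightarrow> f x < 3 * n"
    using assms(3) unfolding embeds_def pverts_clique_fringe by (auto simp: image_subset_iff)
  obtain g where g_inj: "inj_on g ?V" and g_edge:
      "\<And>x y. x \<in> ?V \<Longrightarrow> y \<in> ?V \<Longrightarrow> (x, y) \<in> ?E \<longleftrightarrow> (g x, g y) \<in> parcs (caterpillar m)"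
    using assms(4) unfolding embeds_def by blast
  define K where "K = {v \<in> ?V. f v mod 3 = 0}"
  have K_clique: "(x, y) \<in> ?E" if "x \<in> K" "y \<in> K" "x \<noteq> y" for x y
  proof -
    have "f x \<noteq> f y" using that f_inj by (auto simp: K_def dest: inj_onD)
    with that show ?thesis using f_edge f_verts by (simp add: K_def in_parcs_clique_fringe)
  qed
  have fringe_indep: "(x, y) \<notin> ?E" if "x \<in> ?V - K" "y \<in> ?V - K" for x y
    using that f_edge by (auto simp: K_def in_parcs_clique_fringe)
  have same_block: "(k, v) \<in> ?E \<longleftrightarrow> f v div 3 = f k div 3" if "k \<in> K" "v \<in> ?V - K" for k v
  proof -
    have "k \<in> ?V" "v \<in> ?V" and mods: "f k mod 3 = 0" "f v mod 3 \<noteq> 0" using that by (auto simp: K_def)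
    moreover from mods have "f k \<noteq> f v" by metis
    ultimately show ?thesis
      unfolding f_edge[OF \<open>k \<in> ?V\<close> \<open>v \<in> ?V\<close>] in_parcs_clique_fringe
      using f_verts[of k] f_verts[of v] by metis
  qed
  have K_block: "k = l" if "k \<in> K" "l \<in> K" "f k div 3 = f l div 3" for k l
  proof -
    have "f k = f l" using that unfolding K_def by (metis (mono_tags, lifting) div_mult_mod_eq mem_Collect_eq)
    with that show ?thesis using f_inj by (auto simp: K_def dest: inj_onD)
  qed
  define P where "P k = {v \<in> ?V - K. f v div 3 = f k div 3}" for k
  have P_card: "card (P k) \<le> 2" for k
  proof -
    have "inj_on (\<lambda>v. f v mod 3) (P k)"
    proof (rule inj_onI)
      fix u v assume uv: "u \<in> P k" "v \<in> P k" "f u mod 3 = f v mod 3"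
      then have "f u = f v" unfolding P_def by (metis (mono_tags, lifting) div_mult_mod_eq mem_Collect_eq)
      with uv show "u = v" using f_inj by (auto simp: P_def dest: inj_onD)
    qed
    moreover have "(\<lambda>v. f v mod 3) ` P k \<subseteq> {1, 2}"
      unfolding P_def K_def by auto
    ultimately have "card (P k) \<le> card {1, 2::nat}" by (rule card_inj_on_le) simp
    then show ?thesis by simp
  qed
  have degree: "card N \<le> 3" "g x mod 3 \<noteq> 1 \<Longrightarrow> card N \<le> 2"
    if "x \<in> ?V" "N \<subseteq> ?V" "\<And>v. v \<in> N \<Longrightarrow> (x, v) \<in> ?E" for x N
  proof -
    have "card N \<le> card {y. (g x, y) \<in> parcs (caterpillar m)}"
      using that g_edge inj_on_subset[OF g_inj that(2)]
      by (intro card_neighbours_le_if_inj[OF pair_graph_caterpillar]) blast+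
    also have "\<dots> \<le> (if g x mod 3 = 1 then 3 else 2)" by (rule caterpillar_neighbours)
    finally show "card N \<le> 3" "g x mod 3 \<noteq> 1 \<Longrightarrow> card N \<le> 2" by (auto split: if_splits)
  qed
  have has_neighbour: "\<exists>k\<in>K. v \<in> P k" if v: "v \<in> ?V - K" "?V \<noteq> {v}" for v
  proof -
    obtain w where w: "w \<in> ?V" "(v, w) \<in> ?E" using connected_neighbour[OF H] v by blast
    then have "w \<in> K" using fringe_indep v by blast
    then show ?thesis using same_block[of w v] sym w v unfolding P_def by blast
  qed
  show ?thesis
  proof (cases "\<exists>v. ?V = {v}")
    case True
    then show ?thesis using single by blast
  next
    case not_single: False
    have P_cover: "?V = K \<union> (\<Union>k\<in>K. P k)"
    proof
      show "K \<union> (\<Union>k\<in>K. P k) \<subseteq> ?V" by (auto simp: K_def P_def)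
      show "?V \<subseteq> K \<union> (\<Union>k\<in>K. P k)"
      proof
        fix v assume "v \<in> ?V"
        then show "v \<in> K \<union> (\<Union>k\<in>K. P k)" using has_neighbour[of v] not_single by blast
      qed
    qed
    have "?V \<noteq> {}" using H(2) connected_iff_conn_set[OF H(1)] by (simp add: conn_set_def)
    then obtain y where y: "y \<in> K" using P_cover by blast
    have PK: "P k \<inter> K = {}" for k by (auto simp: P_def)
    have P_disj: "P k \<inter> P l = {}" if "k \<in> K" "l \<in> K" "k \<noteq> l" for k l
      using K_block that by (auto simp: P_def)
    have P_edge: "(k, v) \<in> ?E" if "k \<in> K" "v \<in> P k" for k v
      using that same_block by (auto simp: P_def)
    have P_nonedge: "(k, v) \<notin> ?E" if "k \<in> K" "l \<in> K" "k \<noteq> l" "v \<in> P l" for k l v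
      using that same_block[of k v] K_block[of k l] by (auto simp: P_def)
    have P_indep: "(u, v) \<notin> ?E" if "u \<in> P k" "v \<in> P l" for u v k l
      using that fringe_indep by (auto simp: P_def)
    show ?thesis
    proof (cases "K = {y}")
      case True
      then have V: "?V = insert y (P y)" using P_cover by blast
      then obtain x where x: "x \<in> P y" using not_single by blast
      \<comment> \<open>The graph is a star at \<open>y\<close>, and one of its leaves serves as the other hub.\<close>
      show ?thesis
      proof (rule embeds_T3_if_double_star[OF H(1), of x y "{}" "P y - {x}"])
        show "card (P y - {x}) \<le> 2" using P_card[of y] by (meson card_Diff1_le le_trans)
        show "(x, y) \<in> ?E" by (rule sym) (rule P_edge[OF y x])
        show "?V = {x, y} \<union> {} \<union> (P y - {x})" using V x by blast
        show "y \<notin> {} \<union> (P y - {x})" using PK[of y] y by blast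
        show "(y, b) \<in> ?E \<and> (x, b) \<notin> ?E" if "b \<in> P y - {x}" for b
          using that P_edge[OF y, of b] P_indep[OF x, of b y] by blast
        show "(u, v) \<notin> ?E" if "u \<in> {} \<union> (P y - {x})" "v \<in> {} \<union> (P y - {x})" for u v
          using that P_indep by blast
      qed simp_all
    next
      case False
      then obtain x where x: "x \<in> K" "x \<noteq> y" using y by blast
      have "z = x \<or> z = y" if "z \<in> K" for z
      proof (rule ccontr)
        assume "\<not> ?thesis"
        then have "(x, y) \<in> ?E" "(y, z) \<in> ?E" "(x, z) \<in> ?E" using K_clique x y that by auto
        then show False
          using caterpillar_triangle_free[of "g x" "g y" m "g z"] g_edge x(1) y that
          by (auto simp: K_def)
      qed
      then have K: "K = {x, y}" using x y by blast
      have V: "?V = {x, y} \<union> P x \<union> P y" using P_cover K by blast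
      have xy: "(x, y) \<in> ?E" "(y, x) \<in> ?E" using K_clique x y by auto
      have star: "embeds H T3" if "a \<in> K" "b \<in> K" "a \<noteq> b" "card (P a) \<le> 1" for a b
      proof (rule embeds_T3_if_double_star[OF H(1), of a b "P a" "P b"])
        show "?V = {a, b} \<union> P a \<union> P b" using V K that by blast
        show "P a \<inter> P b = {}" using P_disj that by blast
        show "a \<notin> P a \<union> P b" "b \<notin> P a \<union> P b" using PK that by blast+
        show "(a, b) \<in> ?E" using K_clique that by blast
        show "(u, v) \<notin> ?E" if "u \<in> P a \<union> P b" "v \<in> P a \<union> P b" for u v
          using that P_indep by blast
        show "(a, v) \<in> ?E \<and> (b, v) \<notin> ?E" if "v \<in> P a" for v
          using that P_edge P_nonedge \<open>a \<in> K\<close> \<open>b \<in> K\<close> \<open>a \<noteq> b\<close> by metis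
        show "(b, v) \<in> ?E \<and> (a, v) \<notin> ?E" if "v \<in> P b" for v
          using that P_edge P_nonedge \<open>a \<in> K\<close> \<open>b \<in> K\<close> \<open>a \<noteq> b\<close> by metis
      qed (use that P_card in simp_all)
      have small: "card (P k) \<le> 1" if k: "k \<in> K" "l \<in> K" "k \<noteq> l" "g k mod 3 \<noteq> 1" for k l
      proof -
        have "finite (P k)" "l \<notin> P k" using PK[of k] k pair_finite_verts by (auto simp: P_def)
        then have "Suc (card (P k)) = card (insert l (P k))" by simp
        also have "\<dots> \<le> 2"
        proof (rule degree(2)[of k])
          show "(k, v) \<in> ?E" if "v \<in> insert l (P k)" for v
            using that P_edge K_clique k by blast
        qed (use k P_def K_def in auto)
        finally show ?thesis by simp
      qed
      have "g x mod 3 \<noteq> 1 \<or> g y mod 3 \<noteq> 1"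
        using xy(1) g_edge[of x y] x y hub_edge_parity by (auto simp: K_def in_parcs_caterpillar)
      then show ?thesis using star small x y by metis
    qed
  qed
qed

section \<open>Classification of the minimal pairs\<close>

text \<open>
  Every edge of the copy passes through the centre of the big star, so by connectivity the copy
  contains the centre, unless it is a single vertex.
\<close>

lemma iso_class_eq_star_if_embeds_star:
  assumes H: "pair_graph H" "connected (with_proj H)" and "embeds H (star m)"
  obtains s where "s \<le> m" "iso_class H = iso_class (star s)"
proof -
  interpret pair_graph H by fact
  let ?V = "pverts H"
  obtain f where f_inj: "inj_on f ?V" and f_img: "f ` ?V \<subseteq> {..m}" and f_edge:
      "\<And>x y. x \<in> ?V \<Longrightarrow> y \<in> ?V \<Longrightarrow> (x, y) \<in> parcs H \<longleftrightarrow> (f x, f y) \<in> parcs (star m)"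
    using assms(3) unfolding embeds_def pverts_star by blast
  have "?V \<noteq> {}" using H(2) connected_iff_conn_set[OF H(1)] by (simp add: conn_set_def)
  have "\<exists>c\<in>?V. \<forall>x\<in>?V. \<forall>y\<in>?V. (x, y) \<in> parcs H \<longleftrightarrow> x \<noteq> y \<and> (x = c \<or> y = c)"
  proof (cases "\<exists>v. ?V = {v}")
    case True
    then show ?thesis using pair_graph_irrefl[OF H(1)] by (auto simp: irrefl_def)
  next
    case False
    obtain v where v: "v \<in> ?V" using \<open>?V \<noteq> {}\<close> by blast
    then obtain w where "w \<in> ?V" "(v, w) \<in> parcs H" using connected_neighbour[OF H] False by metis
    then have "\<exists>c\<in>?V. f c = 0" using f_edge v by (auto simp: in_parcs_star)
    then obtain c where c: "c \<in> ?V" "f c = 0" by blast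
    have zero: "f x = 0 \<longleftrightarrow> x = c" if "x \<in> ?V" for x using c that f_inj by (metis inj_onD)
    have "(x, y) \<in> parcs H \<longleftrightarrow> x \<noteq> y \<and> (x = c \<or> y = c)" if "x \<in> ?V" "y \<in> ?V" for x y
    proof -
      have "f x \<le> m" "f y \<le> m" "f x = f y \<longleftrightarrow> x = y"
        using f_img f_inj that by (auto dest: inj_onD)
      with that show ?thesis by (simp add: f_edge in_parcs_star zero)
    qed
    with c show ?thesis by blast
  qed
  then obtain c where c: "c \<in> ?V" and
    E: "\<And>x y. x \<in> ?V \<Longrightarrow> y \<in> ?V \<Longrightarrow> (x, y) \<in> parcs H \<longleftrightarrow> x \<noteq> y \<and> (x = c \<or> y = c)" by blast
  define s where "s = card (?V - {c})"
  have fin: "finite (?V - {c})" using pair_finite_verts by simp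
  have "card {1..s} = s" by simp
  then have "\<exists>h. h ` (?V - {c}) \<subseteq> {1..s} \<and> inj_on h (?V - {c})"
    by (intro card_le_inj[OF fin]) (simp_all add: s_def)
  then obtain h where h: "h ` (?V - {c}) \<subseteq> {1..s}" "inj_on h (?V - {c})" by blast
  let ?h = "\<lambda>v. if v = c then 0 else h v"
  have hs: "1 \<le> h v \<and> h v \<le> s" if "v \<in> ?V" "v \<noteq> c" for v
    using h(1) that by (auto simp: image_subset_iff)
  have h_eq: "?h x = ?h y \<longleftrightarrow> x = y" if "x \<in> ?V" "y \<in> ?V" for x y
    using hs[of x] hs[of y] that inj_onD[OF h(2), of x y] by auto
  have "embeds H (star s)"
  proof (rule embedsI[where f = ?h])
    show "inj_on ?h ?V" using h_eq by (intro inj_onI) blast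
    show "?h v \<in> pverts (star s)" if "v \<in> ?V" for v using hs[of v] that by (auto simp: pverts_star)
    show "(x, y) \<in> parcs H \<longleftrightarrow> (?h x, ?h y) \<in> parcs (star s)" if "x \<in> ?V" "y \<in> ?V" for x y
      using E[OF that] h_eq[OF that] hs[of x] hs[of y] that by (auto simp: in_parcs_star)
  qed
  moreover have "card ?V = Suc s" unfolding s_def by (rule card_Suc_Diff1[OF pair_finite_verts c, symmetric])
  ultimately have "digraph_iso (with_proj H) (with_proj (star s))"
    by (intro digraph_iso_if_embeds_card_le[OF _ H(1) pair_graph_star]) (auto simp: pverts_star)
  then have "iso_class H = iso_class (star s)" by (intro iso_class_eqI[OF H(1) pair_graph_star])
  moreover have "s \<le> m"
    using card_inj_on_le[OF f_inj f_img] \<open>card ?V = Suc s\<close> by simp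
  ultimately show thesis using that by blast
qed

text \<open>
  The image of \<open>f\<close> in \<^const>\<open>T3\<close> is a connected set. It contains 0 and one of 3 and 4, for
  otherwise the graph would embed into the claw, and therefore it contains 1 and 2, which separate
  0 from 3 and 4.
\<close>

lemma iso_class_eq_T3_or_path4:
  assumes H: "pair_graph H" "connected (with_proj H)"
    and "embeds H T3" "\<not> embeds H (star 3)"
  shows "iso_class H = iso_class T3 \<or> iso_class H = iso_class (path_graph 4)"
proof -
  interpret pair_graph H by fact
  let ?V = "pverts H"
  obtain f where f_inj: "inj_on f ?V" and f_img: "f ` ?V \<subseteq> {..<5}" and f_edge:
      "\<And>x y. x \<in> ?V \<Longrightarrow> y \<in> ?V \<Longrightarrow> (x, y) \<in> parcs H \<longleftrightarrow> (f x, f y) \<in> parcs T3"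
    using assms(3) unfolding embeds_def pverts_T3 by blast
  have conn: "conn_set (parcs H) ?V" using H connected_iff_conn_set by blast
  have transfer: "embeds H G" if "f ` ?V \<subseteq> S" "inj_on h S" "h ` S \<subseteq> pverts G"
      "\<forall>x\<in>S. \<forall>y\<in>S. (x, y) \<in> parcs T3 \<longleftrightarrow> (h x, h y) \<in> parcs G"
    for S h and G :: "nat pair_pre_digraph"
  proof (rule embedsI[where f = "h \<circ> f"])
    show "inj_on (h \<circ> f) ?V" using f_inj that(1,2) by (meson comp_inj_on inj_on_subset)
  qed (use that f_edge in \<open>auto simp: image_subset_iff\<close>)
  have not_claw: "\<not> f ` ?V \<subseteq> {1, 2, 3, 4}"
  proof
    assume "f ` ?V \<subseteq> {1, 2, 3, 4}"
    then have "embeds H (star 3)"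
      \<comment> \<open>The list is read at positions 1 to 4 only: the centre 2 goes to 0.\<close>
      by (rule transfer[of _ "\<lambda>i. [0, 1, 0, 2, 3] ! i"])
        (simp_all add: pverts_star in_parcs_star parcs_T3)
    with assms(4) show False by simp
  qed
  have not_path: "\<not> f ` ?V \<subseteq> {0, 1, 2}"
  proof
    assume "f ` ?V \<subseteq> {0, 1, 2}"
    then have "embeds H (star 3)"
      by (rule transfer[of _ "\<lambda>i. [1, 0, 2] ! i"])
        (simp_all add: pverts_star in_parcs_star parcs_T3)
    with assms(4) show False by simp
  qed
  have range5: "i \<in> {0, 1, 2, 3, 4}" if "i \<in> f ` ?V" for i using that f_img by auto
  obtain i where i: "i \<in> f ` ?V" "i \<notin> {1, 2, 3, 4}" using not_claw by (meson subsetI)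
  then have "i = 0" using range5[OF i(1)] by simp
  with i have zero: "0 \<in> f ` ?V" by simp
  obtain j where j: "j \<in> f ` ?V" "j \<notin> {0, 1, 2}" using not_path by (meson subsetI)
  then have "j = 3 \<or> j = 4" using range5[OF j(1)] by simp
  with j have far: "3 \<in> f ` ?V \<or> 4 \<in> f ` ?V" by metis
  have cut: "\<exists>i\<in>S. \<exists>j. j \<in> f ` ?V \<and> j \<notin> S \<and> (i, j) \<in> parcs T3"
    if "0 \<in> S" "3 \<notin> S" "4 \<notin> S" for S
  proof -
    let ?X = "{v \<in> ?V. f v \<in> S}"
    obtain z where "z \<in> ?V" "f z = 3 \<or> f z = 4" using far by auto
    then have "z \<in> ?V" "f z \<notin> S" using that by auto
    then have "?X \<subset> ?V" by blast
    moreover have "?X \<noteq> {}" using zero that(1) by auto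
    ultimately obtain x y where "x \<in> ?X" "y \<in> ?V - ?X" "(x, y) \<in> parcs H"
      by (rule conn_set_cut[OF conn])
    then show ?thesis using f_edge by (intro bexI[of _ "f x"] exI[of _ "f y"]) simp_all
  qed
  obtain j1 where j1: "j1 \<in> f ` ?V" "(0, j1) \<in> parcs T3" using cut[of "{0}"] by auto
  then have "j1 = 1" by (simp add: parcs_T3)
  with j1 have one: "1 \<in> f ` ?V" by metis
  obtain i2 j2 where j2: "j2 \<in> f ` ?V" "i2 \<in> {0, 1}" "j2 \<notin> {0, 1}" "(i2, j2) \<in> parcs T3"
    using cut[of "{0, 1}"] by fastforce
  then have "j2 = 2" by (auto simp: parcs_T3)
  with j2 have two: "2 \<in> f ` ?V" by metis
  have card_img: "card (f ` ?V) = card ?V" using f_inj by (rule card_image)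
  show ?thesis
  proof (cases "3 \<in> f ` ?V \<and> 4 \<in> f ` ?V")
    case True
    then have "{0, 1, 2, 3, 4} \<subseteq> f ` ?V" using zero one two by blast
    then have "card {0, 1, 2, 3, 4::nat} \<le> card (f ` ?V)"
      by (intro card_mono) (simp_all add: pair_finite_verts)
    then have "digraph_iso (with_proj H) (with_proj T3)"
      by (intro digraph_iso_if_embeds_card_le[OF assms(3) H(1) pair_graph_T3])
        (simp add: pverts_T3 card_img)
    then show ?thesis using iso_class_eqI[OF H(1) pair_graph_T3] by blast
  next
    case False
    define k :: nat where "k = (if 3 \<in> f ` ?V then 3 else 4)"
    have "m \<in> {0, 1, 2, k}" if "m \<in> f ` ?V" for m
    proof -
      have "m \<in> {0, 1, 2, 3, 4}" using that by (rule range5)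
      then consider "m \<in> {0, 1, 2}" | "m = 3" | "m = 4" by auto
      then show ?thesis by cases (use False that in \<open>auto simp: k_def\<close>)
    qed
    then have k: "f ` ?V \<subseteq> {0, 1, 2, k}" by (rule subsetI)
    have k34: "k = 3 \<or> k = 4" by (simp add: k_def)
    have k_in: "k \<in> f ` ?V" using far unfolding k_def by presburger
    let ?h = "\<lambda>i. if i = k then 3 else i"
    have "embeds H (path_graph 4)"
    proof (rule transfer[OF k])
      show "inj_on ?h {0, 1, 2, k}" "?h ` {0, 1, 2, k} \<subseteq> pverts (path_graph 4)"
        using k34 by (auto simp: inj_on_def pverts_path_graph)
      show "\<forall>x\<in>{0, 1, 2, k}. \<forall>y\<in>{0, 1, 2, k}.
          (x, y) \<in> parcs T3 \<longleftrightarrow> (?h x, ?h y) \<in> parcs (path_graph 4)"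
        using k34 by (elim disjE) (simp_all add: in_parcs_path4 parcs_T3)
    qed
    moreover have "card {0, 1, 2, k} \<le> card (f ` ?V)"
      using zero one two k_in by (intro card_mono) (simp_all add: pair_finite_verts)
    then have "4 \<le> card ?V" using k34 card_img by auto
    ultimately have "digraph_iso (with_proj H) (with_proj (path_graph 4))"
      by (intro digraph_iso_if_embeds_card_le[OF _ H(1) pair_graph_path4]) (simp_all add: pverts_path_graph)
    then show ?thesis using iso_class_eqI[OF H(1) pair_graph_path4] by blast
  qed
qed

lemma B_deficiency_iff:
  assumes "\<And>H. H \<in> R \<Longrightarrow> pair_graph H" "iso_class ` R \<subseteq> connected_classes"
  shows "iso_class ` R \<in> B_deficiency d \<longleftrightarrow>
    (\<forall>G :: nat pair_pre_digraph. pair_graph G \<and> connected (with_proj G) \<and>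
       (\<forall>H\<in>R. \<not> embeds H G) \<longrightarrow> deficiency G < d)"
proof -
  have "family_free (iso_class ` R) G \<longleftrightarrow> (\<forall>H\<in>R. \<not> embeds H G)" if "pair_graph G" for G
    by (rule family_free_iff[OF assms(1) that])
  then show ?thesis using assms(2) unfolding B_deficiency_def by (simp cong: conj_cong)
qed

lemma B_deficiency_mono:
  assumes "\<H>' \<in> B_deficiency d" "\<H>' \<subseteq> \<H>" "\<H> \<subseteq> connected_classes"
  shows "\<H> \<in> B_deficiency d"
proof -
  have "family_free \<H>' G" if "family_free \<H> G" for G
    using that assms(2) unfolding family_free_def by blast
  then show ?thesis using assms(1,3) unfolding B_deficiency_def by simp
qed

text \<open>
  A graph without an induced claw contains neither $K_{1,3}$ nor $T_3$, so it has deficiency at most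
  one.
\<close>

lemma singleton_B_deficiency_if_embeds_claw:
  assumes "pair_graph H" "iso_class H \<in> connected_classes" "embeds H (star 3)" "2 \<le> d"
  shows "{iso_class H} \<in> B_deficiency d"
proof -
  have "deficiency G < d" if G: "pair_graph G" "connected (with_proj G)" "\<not> embeds H G" for G
  proof -
    have "\<not> embeds (star 3) G" "\<not> embeds T3 G"
      using G(3) assms(3) embeds_star3_T3 embeds_trans by blast+
    then have "deficiency G \<le> int 3 - 2"
      using G by (intro deficiency_le_if_fork_star_free) auto
    with \<open>2 \<le> d\<close> show ?thesis by simp
  qed
  then show ?thesis using B_deficiency_iff[of "{H}" d] assms(1,2) by auto
qed

lemma star_fork_in_B_deficiency:
  assumes "3 \<le> s" "int s \<le> d + 1" "pair_graph H" "embeds H T3"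
    and "{iso_class (star s), iso_class H} \<subseteq> connected_classes"
  shows "{iso_class (star s), iso_class H} \<in> B_deficiency d"
proof -
  have "deficiency G < d" if G: "pair_graph G" "connected (with_proj G)"
      "\<not> embeds (star s) G" "\<not> embeds H G" for G
  proof -
    have "\<not> embeds T3 G" using G(4) assms(4) embeds_trans by blast
    then have "deficiency G \<le> int s - 2"
      using G assms(1) by (intro deficiency_le_if_fork_star_free) auto
    with assms(2) show ?thesis by simp
  qed
  then show ?thesis
    using B_deficiency_iff[of "{star s, H}" d] assms(3,5) pair_graph_star by auto
qed

lemma singleton_star_notin_B_deficiency:
  assumes "4 \<le> s" "0 < d"
  shows "{iso_class (star s)} \<notin> B_deficiency d"
proof
  assume B: "{iso_class (star s)} \<in> B_deficiency d"
  then have "{iso_class (star s)} \<subseteq> connected_classes" by (simp add: B_deficiency_def)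
  moreover have "\<not> embeds (star s) (caterpillar (nat d))"
    using not_embeds_star4_caterpillar embeds_star_mono[OF assms(1)] embeds_trans by blast
  ultimately have "deficiency (caterpillar (nat d)) < d"
    using B B_deficiency_iff[of "{star s}" d] assms(2) pair_graph_star pair_graph_caterpillar
      connected_caterpillar[of "nat d"] by auto
  then show False using deficiency_caterpillar[of "nat d"] assms(2) by simp
qed

lemma singleton_notin_B_deficiency_if_path4_embeds:
  assumes "pair_graph H" "embeds (path_graph 4) H" "0 < d"
  shows "{iso_class H} \<notin> B_deficiency d"
proof
  assume B: "{iso_class H} \<in> B_deficiency d"
  then have "{iso_class H} \<subseteq> connected_classes" by (simp add: B_deficiency_def)
  moreover have "\<not> embeds H (star (nat d + 1))"
    using not_embeds_path4_star assms(2) embeds_trans by blast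
  ultimately have "deficiency (star (nat d + 1)) < d"
    using B B_deficiency_iff[of "{H}" d] assms(1) pair_graph_star
      connected_star[of "nat d + 1"] by auto
  then show False using deficiency_star[of "nat d + 1"] assms(3) by simp
qed

text \<open>
  The clique with leaves and the caterpillar do not contain $K_{1,4}$, hence not \<open>H1\<close>, so both
  contain \<open>H2\<close>.
\<close>

lemma minimal_pair_classification:
  assumes "d \<ge> 3"
    and H: "pair_graph H1" "connected (with_proj H1)" "pair_graph H2" "connected (with_proj H2)"
    and B: "{iso_class H1, iso_class H2} \<in> B_deficiency d"
    and min: "{iso_class H1} \<notin> B_deficiency d" "{iso_class H2} \<notin> B_deficiency d"
    and star: "embeds H1 (star (nat d + 1))"
  shows "\<exists>s. 4 \<le> s \<and> int s \<le> d + 1 \<and> iso_class H1 = iso_class (star s) \<and>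
    (iso_class H2 = iso_class T3 \<or> iso_class H2 = iso_class (path_graph 4))"
proof -
  have conn: "{iso_class H1, iso_class H2} \<subseteq> connected_classes"
    using B by (simp add: B_deficiency_def)
  have claw: "\<not> embeds H1 (star 3)" "\<not> embeds H2 (star 3)"
    using singleton_B_deficiency_if_embeds_claw[of _ d] H conn min \<open>d \<ge> 3\<close> by auto
  obtain s where s: "s \<le> nat d + 1" "iso_class H1 = iso_class (star s)"
    using iso_class_eq_star_if_embeds_star[OF H(1,2) star] by blast
  then have "H1 \<in> iso_class (star s)" "star s \<in> iso_class H1"
    using iso_class_self H(1) pair_graph_star by blast+
  then have iso: "embeds H1 (star s)" "embeds (star s) H1"
    using H(1) pair_graph_star digraph_iso_imp_embeds by (auto simp: iso_class_def)
  have "4 \<le> s"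
  proof (rule ccontr)
    assume "\<not> 4 \<le> s"
    then have "embeds H1 (star 3)" using iso(1) embeds_star_mono[of s 3] embeds_trans by simp
    with claw show False by simp
  qed
  have "embeds H2 G" if G: "pair_graph G" "connected (with_proj G)" "d \<le> deficiency G"
      "\<not> embeds (star 4) G" for G :: "nat pair_pre_digraph"
  proof -
    have "\<not> embeds H1 G"
      using G(4) embeds_star_mono[OF \<open>4 \<le> s\<close>] iso(2) embeds_trans by blast
    then show ?thesis
      using B B_deficiency_iff[of "{H1, H2}" d] H conn G by force
  qed
  from this[of "clique_fringe (nat d)"] this[of "caterpillar (nat d)"]
  have "embeds H2 (clique_fringe (nat d))" "embeds H2 (caterpillar (nat d))"
    using pair_graph_clique_fringe pair_graph_caterpillar connected_clique_fringe[of "nat d"]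
      connected_caterpillar[of "nat d"] deficiency_clique_fringe[of "nat d"]
      deficiency_caterpillar[of "nat d"] not_embeds_star4_caterpillar
      not_embeds_star4_clique_fringe \<open>d \<ge> 3\<close> by auto
  then have "embeds H2 T3" using embeds_T3_if_embeds_clique_fringe_caterpillar H by blast
  then have "iso_class H2 = iso_class T3 \<or> iso_class H2 = iso_class (path_graph 4)"
    using iso_class_eq_T3_or_path4 H claw by blast
  with s \<open>4 \<le> s\<close> \<open>d \<ge> 3\<close> show ?thesis by (intro exI[of _ s]) auto
qed

theorem theorem1p9:
  fixes d :: int and \<H> :: "graph_class set"
  assumes "d \<ge> 3"
    and "\<H> \<subseteq> connected_classes"
    and "card \<H> = 2"
  shows "(\<H> \<in> B_deficiency d \<and> (\<forall>\<H>'. \<H>' \<subset> \<H> \<longrightarrow> \<H>' \<notin> B_deficiency d)) \<longleftrightarrow>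
    (\<exists>s::nat. 4 \<le> s \<and> int s \<le> d + 1 \<and>
       (\<H> = {iso_class (star s), iso_class T3} \<or>
        \<H> = {iso_class (star s), iso_class (path_graph 4)}))"
  (is "?minimal \<longleftrightarrow> (\<exists>s. ?pair s)")
proof
  assume ?minimal
  obtain C1 C2 where C: "\<H> = {C1, C2}" "C1 \<noteq> C2" using assms(3) by (auto simp: card_2_iff)
  then obtain H1 H2 where H: "C1 = iso_class H1" "pair_graph H1" "connected (with_proj H1)"
      "C2 = iso_class H2" "pair_graph H2" "connected (with_proj H2)"
    using assms(2) unfolding connected_classes_def by auto
  have B: "{iso_class H1, iso_class H2} \<in> B_deficiency d"
    "{iso_class H2, iso_class H1} \<in> B_deficiency d"
    using \<open>?minimal\<close> C H by (simp_all add: insert_commute)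
  have "{C1} \<subset> \<H>" "{C2} \<subset> \<H>" using C by auto
  then have min: "{iso_class H1} \<notin> B_deficiency d" "{iso_class H2} \<notin> B_deficiency d"
    using \<open>?minimal\<close> H by auto
  have "\<not> deficiency (star (nat d + 1)) < d" using deficiency_star[of "nat d + 1"] assms(1) by simp
  then have "embeds H1 (star (nat d + 1)) \<or> embeds H2 (star (nat d + 1))"
    using B(1) B_deficiency_iff[of "{H1, H2}" d] H C assms(2) pair_graph_star connected_star by auto
  then show "\<exists>s. ?pair s"
  proof
    assume "embeds H1 (star (nat d + 1))"
    then show ?thesis
      using minimal_pair_classification[OF assms(1) H(2,3,5,6) B(1) min] C(1) H(1,4) by auto
  next
    assume "embeds H2 (star (nat d + 1))"
    then show ?thesis
      using minimal_pair_classification[OF assms(1) H(5,6,2,3) B(2) min(2,1)] C(1) H(1,4)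
      by (auto simp: insert_commute)
  qed
next
  assume "\<exists>s. ?pair s"
  then obtain s K where s: "4 \<le> s" "int s \<le> d + 1" and K: "K = T3 \<or> K = path_graph 4"
    and \<H>: "\<H> = {iso_class (star s), iso_class K}" by blast
  have K': "pair_graph K" "embeds K T3" "embeds (path_graph 4) K"
    using K pair_graph_T3 pair_graph_path4 embeds_refl embeds_path4_T3 by auto
  have "\<H> \<in> B_deficiency d"
    using star_fork_in_B_deficiency[of s d K] s K' assms(2) unfolding \<H> by simp
  moreover have "\<H>' \<notin> B_deficiency d" if "\<H>' \<subset> \<H>" for \<H>'
  proof
    assume B: "\<H>' \<in> B_deficiency d"
    have "\<H>' \<subseteq> {iso_class (star s)} \<or> \<H>' \<subseteq> {iso_class K}" using that unfolding \<H> by blast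
    then have "{iso_class (star s)} \<in> B_deficiency d \<or> {iso_class K} \<in> B_deficiency d"
      using B_deficiency_mono[OF B] assms(2) unfolding \<H> by blast
    then show False
      using singleton_star_notin_B_deficiency[OF s(1), of d]
        singleton_notin_B_deficiency_if_path4_embeds[OF K'(1,3), of d] assms(1) by auto
  qed
  ultimately show ?minimal by blast
qed

end
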